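(* Let $(E,\{l_k\}_{k\in\mathbb N})$ and $(V,\{m_k\}_{k\in\mathbb N})$ be Lie $\infty$-algebras (shifted convention, see context), with codifferential $M_V$ on $\bar S(V)$ having components $m_k$, and let $\Phi:(E,\{l_k\}_{k\in\mathbb N})\to(\mathrm{Coder}(\bar S(V))[1],\partial_{M_V},[\cdot,\cdot])$ be a Lie $\infty$-action. Equip $E\oplus V$ with the degree $+1$ multilinear maps $\mathfrak l_n:(E\oplus V)^{\otimes n}\to E\oplus V$, $n\ge 1$, defined by $$\mathfrak l_n(x_1+v_1,\dots,x_n+v_n)=l_n(x_1,\dots,x_n)+\sum_{i=1}^{n-1}\Phi^{i,n-i}(x_1,\dots,x_i;v_{i+1},\dots,v_n)+m_n(v_1,\dots,v_n),$$ for $x_j\in E$, $v_j\in V$. Then the coderivation of the Zinbiel coalgebra $T^Z(E\oplus V)$ determined by $\{\mathfrak l_n\}_{n\in\mathbb N}$ squares to zero (i.e. $(E\oplus V,\{\mathfrak l_n\})$ is a Loday $\infty$-algebra) if and only if $\Phi$ is a coherent action.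
   Context: All vector spaces are $\mathbb Z$-graded over $\mathbb K=\mathbb R$ or $\mathbb C$ and the Koszul sign rule is used; $\epsilon(\sigma)$ denotes the Koszul sign of a permutation $\sigma$ acting on homogeneous elements, and $Sh(i_1,\dots,i_k)$ the set of $(i_1,\dots,i_k)$-unshuffles. For a graded space $V$, $\bar S(V)=\bigoplus_{k\ge1}S^k(V)$ (graded-symmetric powers, product written $\cdot$) carries the coshuffle coproduct $\Delta^c(v_1\cdots v_k)=\sum_{p=1}^{k-1}\sum_{\sigma\in Sh(p,k-p)}\epsilon(\sigma)(v_{\sigma(1)}\cdots v_{\sigma(p)})\otimes(v_{\sigma(p+1)}\cdots v_{\sigma(k)})$, and $p:\bar S(V)\to V$ is the projection; a coderivation $Q$ of $(\bar S(V),\Delta^c)$ is determined by its components $p\circ Q|_{S^k(V)}:S^k(V)\to V$. A Lie $\infty$-algebra (in the shifted, "Lie[1]", convention used throughout) is a graded space $V$ with a degree $+1$ coderivation $M_V$ of $(\bar S(V),\Delta^c)$ with $M_V^2=0$; its components $m_k:S^k(V)\to V$ are degree $+1$ graded-symmetric brackets. A Lie $\infty$-morphism $E\to V$ is a degree $0$ coalgebra morphism $F:\bar S(E)\to\bar S(V)$ with $F\circ M_E=M_V\circ F$. For a Lie $\infty$-algebra $(V,M_V)$, the space $\mathrm{Coder}(\bar S(V))[1]$ is a Lie $\infty$-algebra (shifted differential graded Lie algebra) with unary bracket $\partial_{M_V}Q=-M_V\circ Q+(-1)^{|Q|+1}Q\circ M_V$ and binary bracket $[Q,P]=(-1)^{|Q|+1}\big(Q\circ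 P-(-1)^{(|Q|+1)(|P|+1)}P\circ Q\big)$ (no higher brackets). A Lie $\infty$-action of $(E,\{l_k\})$ on $(V,\{m_k\})$ is a Lie $\infty$-morphism $\Phi$ from $E$ to this Lie $\infty$-algebra. For $x\in\bar S(E)$ write $\Phi_x\in\mathrm{Coder}(\bar S(V))$ for the coderivation assigned to $x$ by the components $S^k(E)\to\mathrm{Coder}(\bar S(V))$ of $\Phi$, and set $\Phi^{k,n}(x;v)=p(\Phi_x(v))\in V$ for $x\in S^k(E)$, $v\in S^n(V)$ (written $\Phi^{k,n}(x_1,\dots,x_k;v_1,\dots,v_n)$ for $x=x_1\cdots x_k$, $v=v_1\cdots v_n$); $\Phi^{\bullet,\bullet}$ denotes the sum over all $k,n$. For $v\in S^k(V)$ let $\mathrm{ad}_v$ be the coderivation of $\bar S(V)$ with components $w\mapsto m_{k+i}(v\cdot w)$, $w\in S^i(V)$, extended linearly to $v\in\bar S(V)$. For $y\in\bar S(E)$, $v\in\bar S(V)$ let $\Phi_{y;v}$ be the coderivation of $\bar S(V)$ with components $w\mapsto\Phi^{\bullet,\bullet}(y;v\cdot w)$. The action $\Phi$ is coherent if $[\mathrm{ad}_v,\Phi_x]=0$ and $[\Phi_{y;v},\Phi_x]=0$ for all $x,y\in\bar S(E)$ and $v\in\bar S(V)$. Loday $\infty$-algebras (shifted convention): $\bar T(W)=\bigoplus_{k\ge1}W^{\otimes k}$ with the Zinbiel coproduct $\Delta^Z(w)=0$ for $w\in W$ and $\Delta^Z(w_1\otimes\cdots\otimes w_k)=\sum_{p=1}^{k-1}\sum_{\sigma\in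 Sh(p,k-p-1)}\epsilon(\sigma)(w_{\sigma(1)}\otimes\cdots\otimes w_{\sigma(p)})\otimes(w_{\sigma(p+1)}\otimes\cdots\otimes w_{\sigma(k-1)}\otimes w_k)$ is denoted $T^Z(W)$. A family of maps $Q_k:W^{\otimes k}\to W$ of degree $|Q|$ determines the coderivation $Q(w_1\otimes\cdots\otimes w_n)=\sum_{k=1}^n\sum_{i=0}^{n-k}\sum_{\sigma\in Sh(i,k-1)}(-1)^{|Q|(|w_{\sigma(1)}|+\cdots+|w_{\sigma(i)}|)}\epsilon(\sigma)\,w_{\sigma(1)}\otimes\cdots\otimes w_{\sigma(i)}\otimes Q_k(w_{\sigma(i+1)},\dots,w_{\sigma(i+k-1)},w_{i+k})\otimes w_{i+k+1}\otimes\cdots\otimes w_n$ of $T^Z(W)$, and every coderivation arises this way. A Loday $\infty$-algebra is a graded space $W$ with a degree $+1$ coderivation of $T^Z(W)$ squaring to zero. *)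

theory Defs
  imports "HOL-Analysis.Analysis"
begin

(* Conventions.  A graded real vector space is a type 'v::real_vector  *)
(* together with H :: int => 'v set, H d = homogeneous part of degree *)
(* d, which must form an (internal) direct sum decomposition.          *)
(* A homogeneous element is recorded as a pair (d, v) with v \<in> H d;   *)
(* Koszul signs are computed from the degree tags.  Multilinear maps   *)
(* out of S^k(V) / W^{ox k} are encoded as maps on lists of length k.  *)

definition ksgn :: "int \<Rightarrow> real" where
  "ksgn k = (if even k then 1 else -1)"

definition graded_space :: "(int \<Rightarrow> 'v::real_vector set) \<Rightarrow> bool" where
  "graded_space H \<longleftrightarrow> (\<forall>d. subspace (H d)) \<and>
     (\<forall>v. \<exists>!c. finite {d. c d \<noteq> 0} \<and> (\<forall>d. c d \<in> H d) \<and> v = sum c {d. c d \<noteq> 0})"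

definition hom :: "(int \<Rightarrow> 'v set) \<Rightarrow> (int \<times> 'v) list \<Rightarrow> bool" where
  "hom H gs \<longleftrightarrow> (\<forall>(d, v) \<in> set gs. v \<in> H d)"

definition degsum :: "(int \<times> 'v) list \<Rightarrow> int" where
  "degsum gs = sum_list (map fst gs)"

definition vals :: "(int \<times> 'v) list \<Rightarrow> 'v list" where
  "vals gs = map snd gs"

(* Koszul sign of the unshuffle putting the positions in S first (in order),
   then the remaining positions (in order), for the list of degrees ds. *)
definition ksign :: "int list \<Rightarrow> nat set \<Rightarrow> real" where
  "ksign ds S = ksgn (\<Sum>a<length ds. \<Sum>b<a. if a \<in> S \<and> b \<notin> S then ds ! a * ds ! b else 0)"

(* nonempty subsets of positions {0..<n}: (i,n-i)-unshuffles, i >= 1 *)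
definition nsubs :: "nat \<Rightarrow> nat set set" where
  "nsubs n = Pow {0..<n} - {{}}"

definition multilinear :: "('v::real_vector list \<Rightarrow> 'w::real_vector) \<Rightarrow> bool" where
  "multilinear f \<longleftrightarrow> (\<forall>xs ys b c. f (xs @ (b + c) # ys) = f (xs @ b # ys) + f (xs @ c # ys)) \<and>
                      (\<forall>xs ys a b. f (xs @ (a *\<^sub>R b) # ys) = a *\<^sub>R f (xs @ b # ys))"

definition graded_symmetric :: "(int \<Rightarrow> 'v set) \<Rightarrow> ('v list \<Rightarrow> 'w::real_vector) \<Rightarrow> bool" where
  "graded_symmetric H f \<longleftrightarrow> (\<forall>xs a b ys. hom H (xs @ a # b # ys) \<longrightarrow>
      f (vals (xs @ a # b # ys)) = ksgn (fst a * fst b) *\<^sub>R f (vals (xs @ b # a # ys)))"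

definition has_degree :: "(int \<Rightarrow> 'v set) \<Rightarrow> int \<Rightarrow> ('v list \<Rightarrow> 'v) \<Rightarrow> bool" where
  "has_degree H q f \<longleftrightarrow> (\<forall>gs. gs \<noteq> [] \<and> hom H gs \<longrightarrow> f (vals gs) \<in> H (degsum gs + q))"

(* Projection p o Q o P on S^n(V) of the composite of the coderivations of
   S(V) with components q (outer) and p (inner), evaluated at v_1...v_n:
   sum over unshuffles of eps * q(p(v_S) . v_{S^c}). *)
definition cmp :: "('v list \<Rightarrow> 'v::real_vector) \<Rightarrow> ('v list \<Rightarrow> 'v) \<Rightarrow> (int \<times> 'v) list \<Rightarrow> 'v" where
  "cmp q p gs = (\<Sum>S\<in>nsubs (length gs).
      ksign (map fst gs) S *\<^sub>R q (p (vals (nths gs S)) # vals (nths gs (- S))))"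

(* Lie infinity algebra (shifted convention): components m_k of a degree +1
   coderivation M of S(V) with M o M = 0 (equivalently p o M o M = 0, as
   M o M is a coderivation). *)
definition lie_infty :: "(int \<Rightarrow> 'v::real_vector set) \<Rightarrow> ('v list \<Rightarrow> 'v) \<Rightarrow> bool" where
  "lie_infty H m \<longleftrightarrow> graded_space H \<and> multilinear m \<and> graded_symmetric H m \<and> has_degree H 1 m \<and>
     (\<forall>gs. gs \<noteq> [] \<and> hom H gs \<longrightarrow> cmp m m gs = 0)"

(* Components of the operations of Coder(S(V))[1]; dq, dp are degrees in
   Coder(S(V))[1] (coderivation degree minus one). *)
definition cdiff :: "('v list \<Rightarrow> 'v::real_vector) \<Rightarrow> int \<Rightarrow> ('v list \<Rightarrow> 'v) \<Rightarrow> (int \<times> 'v) list \<Rightarrow> 'v" where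
  "cdiff m dq q gs = - cmp m q gs + ksgn (dq + 1) *\<^sub>R cmp q m gs"

definition cbr :: "int \<Rightarrow> ('v list \<Rightarrow> 'v::real_vector) \<Rightarrow> int \<Rightarrow> ('v list \<Rightarrow> 'v) \<Rightarrow> (int \<times> 'v) list \<Rightarrow> 'v" where
  "cbr dq q dp p gs = ksgn (dq + 1) *\<^sub>R (cmp q p gs - ksgn ((dq + 1) * (dp + 1)) *\<^sub>R cmp p q gs)"

(* Lie infinity action: Phi xs vs = Phi^{k,n}(x_1..x_k; v_1..v_n).
   Phi is a degree 0 Lie infinity morphism E -> Coder(S(V))[1]. *)
definition lie_infty_action ::
  "(int \<Rightarrow> 'e::real_vector set) \<Rightarrow> ('e list \<Rightarrow> 'e) \<Rightarrow> (int \<Rightarrow> 'v::real_vector set) \<Rightarrow> ('v list \<Rightarrow> 'v)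
     \<Rightarrow> ('e list \<Rightarrow> 'v list \<Rightarrow> 'v) \<Rightarrow> bool" where
  "lie_infty_action HE l HV m \<Phi> \<longleftrightarrow>
     (\<forall>vs. multilinear (\<lambda>xs. \<Phi> xs vs)) \<and> (\<forall>xs. multilinear (\<Phi> xs)) \<and>
     (\<forall>vs. graded_symmetric HE (\<lambda>xs. \<Phi> xs vs)) \<and> (\<forall>xs. graded_symmetric HV (\<Phi> xs)) \<and>
     (\<forall>xs vs. xs \<noteq> [] \<and> vs \<noteq> [] \<and> hom HE xs \<and> hom HV vs \<longrightarrow>
        \<Phi> (vals xs) (vals vs) \<in> HV (degsum xs + degsum vs + 1)) \<and>
     (\<forall>xs vs. xs \<noteq> [] \<and> vs \<noteq> [] \<and> hom HE xs \<and> hom HV vs \<longrightarrow>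
        (\<Sum>S\<in>nsubs (length xs). ksign (map fst xs) S *\<^sub>R
            \<Phi> (l (vals (nths xs S)) # vals (nths xs (- S))) (vals vs))
        = cdiff m (degsum xs) (\<Phi> (vals xs)) vs
          + (1/2) *\<^sub>R (\<Sum>S\<in>nsubs (length xs) - {{0..<length xs}}. ksign (map fst xs) S *\<^sub>R
               cbr (degsum (nths xs S)) (\<Phi> (vals (nths xs S)))
                   (degsum (nths xs (- S))) (\<Phi> (vals (nths xs (- S)))) vs))"

(* Coherence: [ad_v, Phi_x] = 0 and [Phi_{y;v}, Phi_x] = 0, checked on
   homogeneous monomials x, y in S(E), v in S(V) (by linearity this is
   the same as for all elements), componentwise on all w in S(V). *)
definition coherent ::
  "(int \<Rightarrow> 'e::real_vector set) \<Rightarrow> (int \<Rightarrow> 'v::real_vector set) \<Rightarrow> ('v list \<Rightarrow> 'v)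
     \<Rightarrow> ('e list \<Rightarrow> 'v list \<Rightarrow> 'v) \<Rightarrow> bool" where
  "coherent HE HV m \<Phi> \<longleftrightarrow>
     (\<forall>xs vs ws. xs \<noteq> [] \<and> vs \<noteq> [] \<and> ws \<noteq> [] \<and> hom HE xs \<and> hom HV vs \<and> hom HV ws \<longrightarrow>
        cbr (degsum vs) (\<lambda>us. m (vals vs @ us)) (degsum xs) (\<Phi> (vals xs)) ws = 0) \<and>
     (\<forall>xs ys vs ws. xs \<noteq> [] \<and> ys \<noteq> [] \<and> vs \<noteq> [] \<and> ws \<noteq> [] \<and>
          hom HE xs \<and> hom HE ys \<and> hom HV vs \<and> hom HV ws \<longrightarrow>
        cbr (degsum ys + degsum vs) (\<lambda>us. \<Phi> (vals ys) (vals vs @ us)) (degsum xs) (\<Phi> (vals xs)) ws = 0)"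

definition semidirect_brackets ::
  "('e::real_vector list \<Rightarrow> 'e) \<Rightarrow> ('e list \<Rightarrow> 'v list \<Rightarrow> 'v) \<Rightarrow> ('v::real_vector list \<Rightarrow> 'v)
     \<Rightarrow> ('e \<times> 'v) list \<Rightarrow> 'e \<times> 'v" where
  "semidirect_brackets l \<Phi> m ws =
     (l (map fst ws),
      (\<Sum>i\<in>{1..<length ws}. \<Phi> (take i (map fst ws)) (drop i (map snd ws))) + m (map snd ws))"

(* Projection p o Q o P on W^{ox n} of the composite of the coderivations of
   the Zinbiel coalgebra T^Z(W) with components q (outer) and p (inner, of
   degree dp), per the coderivation formula of the context:
   j = i+k-1 is the (0-based) position of the last input of p, T the
   positions among 0..<j placed before p (an (i,k-1)-unshuffle). *)
definition zcmp :: "('w list \<Rightarrow> 'w::real_vector) \<Rightarrow> int \<Rightarrow> ('w list \<Rightarrow> 'w) \<Rightarrow> (int \<times> 'w) list \<Rightarrow> 'w" where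
  "zcmp q dp p gs = (\<Sum>j<length gs. \<Sum>T\<in>Pow {0..<j}.
      (ksgn (dp * degsum (nths (take j gs) T)) * ksign (map fst (take j gs)) T) *\<^sub>R
      q (vals (nths (take j gs) T) @ [p (vals (nths (take j gs) (- T)) @ [snd (gs ! j)])]
         @ vals (drop (Suc j) gs)))"

(* The degree +1 coderivation of T^Z(W) with components L squares to zero
   (equivalently its square, itself a coderivation, has zero components). *)
definition loday_sq_zero :: "(int \<Rightarrow> 'w::real_vector set) \<Rightarrow> ('w list \<Rightarrow> 'w) \<Rightarrow> bool" where
  "loday_sq_zero H L \<longleftrightarrow> (\<forall>gs. gs \<noteq> [] \<and> hom H gs \<longrightarrow> zcmp L 1 L gs = 0)"

end

theory Submission
  imports Defs
begin

text \<open>By multilinearity it suffices to evaluate the square of the coderivation on words whose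
  letters lie in \<open>E\<close> or in \<open>V\<close>. On words with all \<open>E\<close>-letters in front the value is the Jacobi
  identity of \<open>E\<close> or \<open>V\<close> or the defining equation of the action, hence zero. Any other word
  has the form \<open>x u w\<close>, where \<open>x\<close> consists of \<open>E\<close>-letters, \<open>w\<close> of \<open>V\<close>-letters, and \<open>u\<close> begins
  in \<open>V\<close> and ends in \<open>E\<close>. A bracket vanishes as soon as a \<open>V\<close>-input precedes an \<open>E\<close>-input, so
  the \<open>V\<close>-letters \<open>v\<close> of \<open>u\<close> must all enter one of the two nested brackets and its
  \<open>E\<close>-letters \<open>y\<close> the other one. The value is therefore, up to sign,
  the sum over unshuffles \<open>x = x' x''\<close> of the signed brackets
  \<open>[\<Phi>_{x';v}, \<Phi>_{x'' y}](w)\<close>, where \<open>\<Phi>_{x';v}\<close> stands for \<open>ad_v\<close> if \<open>x'\<close> is empty.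
  Coherence makes every summand vanish; conversely, the individual brackets vanish by induction
  on the length of \<open>x\<close>.\<close>

section \<open>Signed sums over unshuffles\<close>

lemma ksgn_0 [simp]: "ksgn 0 = 1"
  by (simp add: ksgn_def)

lemma degsum_simps [simp]:
  "degsum [] = 0" "degsum (g # gs) = fst g + degsum gs" "degsum (gs @ hs) = degsum gs + degsum hs"
  by (simp_all add: degsum_def)

lemma vals_simps [simp]:
  "vals [] = []" "vals (g # gs) = snd g # vals gs" "vals (gs @ hs) = vals gs @ vals hs"
  "vals gs = [] \<longleftrightarrow> gs = []"
  by (simp_all add: vals_def)

lemma hom_simps [simp]:
  "hom H []" "hom H (g # gs) \<longleftrightarrow> snd g \<in> H (fst g) \<and> hom H gs"
  "hom H (gs @ hs) \<longleftrightarrow> hom H gs \<and> hom H hs"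
  by (auto simp: hom_def)

lemma hom_subset: "hom H hs \<Longrightarrow> set gs \<subseteq> set hs \<Longrightarrow> hom H gs"
  by (auto simp: hom_def)

text \<open>The sums over sets of positions used in the definitions, in recursive form: the letters are
  distributed one by one from the left.\<close>

primrec unsh_sum :: "((int \<times> 'a) list \<Rightarrow> (int \<times> 'a) list \<Rightarrow> 'w::real_vector) \<Rightarrow> (int \<times> 'a) list \<Rightarrow> 'w" where
  "unsh_sum F [] = F [] []"
| "unsh_sum F (g # gs) = unsh_sum (\<lambda>L R. F (g # L) R) gs
     + unsh_sum (\<lambda>L R. ksgn (fst g * degsum L) *\<^sub>R F L (g # R)) gs"

text \<open>\<open>T\<close> collects the outer inputs before the inner bracket, \<open>S\<close>
  the inner inputs, \<open>r\<close> the tail. The summand \<open>G [] [g] gs\<close> closes the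
  inner block at \<open>g\<close>; the empty word has no letter at which to close it, hence the
  value 0.\<close>

primrec zinb_sum :: "((int \<times> 'a) list \<Rightarrow> (int \<times> 'a) list \<Rightarrow> (int \<times> 'a) list \<Rightarrow> 'w::real_vector)
    \<Rightarrow> (int \<times> 'a) list \<Rightarrow> 'w" where
  "zinb_sum G [] = 0"
| "zinb_sum G (g # gs) = G [] [g] gs + zinb_sum (\<lambda>T S r. G (g # T) S r) gs
     + zinb_sum (\<lambda>T S r. ksgn (fst g * degsum T) *\<^sub>R G T (g # S) r) gs"

lemma unsh_sum_cong:
  assumes "\<And>L R. mset L + mset R = mset gs \<Longrightarrow> F L R = F' L R"
  shows "unsh_sum F gs = unsh_sum F' gs"
  using assms
proof (induction gs arbitrary: F F')
  case (Cons g gs)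
  have "unsh_sum (\<lambda>L R. F (g # L) R) gs = unsh_sum (\<lambda>L R. F' (g # L) R) gs"
    by (rule Cons.IH) (simp add: Cons.prems)
  moreover have "unsh_sum (\<lambda>L R. ksgn (fst g * degsum L) *\<^sub>R F L (g # R)) gs
      = unsh_sum (\<lambda>L R. ksgn (fst g * degsum L) *\<^sub>R F' L (g # R)) gs"
    by (rule Cons.IH) (simp add: Cons.prems)
  ultimately show ?case by simp
qed simp

lemma unsh_sum_scaleR: "unsh_sum (\<lambda>L R. c *\<^sub>R F L R) gs = c *\<^sub>R unsh_sum F gs"
proof (induction gs arbitrary: F)
  case (Cons g gs)
  show ?case
    using Cons.IH[of "\<lambda>L R. F (g # L) R"] Cons.IH[of "\<lambda>L R. ksgn (fst g * degsum L) *\<^sub>R F L (g # R)"]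
    by (simp add: scaleR_right_distrib mult.commute)
qed simp

lemma unsh_sum_add: "unsh_sum (\<lambda>L R. F L R + F' L R) gs = unsh_sum F gs + unsh_sum F' gs"
  by (induction gs arbitrary: F F') (simp_all add: scaleR_right_distrib)

lemma unsh_sum_diff: "unsh_sum (\<lambda>L R. F L R - F' L R) gs = unsh_sum F gs - unsh_sum F' gs"
  by (induction gs arbitrary: F F') (simp_all add: scaleR_right_diff_distrib)

lemma unsh_sum_0 [simp]: "unsh_sum (\<lambda>L R. 0) gs = 0"
  by (induction gs) simp_all

text \<open>The two factors are unshuffled independently; the sign arises because \<open>L'\<close>
  has to pass \<open>R\<close>.\<close>

lemma unsh_sum_append:
  "unsh_sum F (gs @ hs) =
     unsh_sum (\<lambda>L R. unsh_sum (\<lambda>L' R'. ksgn (degsum R * degsum L') *\<^sub>R F (L @ L') (R @ R')) hs) gs"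
proof (induction gs arbitrary: F)
  case (Cons g gs)
  have "unsh_sum (\<lambda>L' R'. ksgn (degsum R * degsum L') *\<^sub>R ksgn (fst g * degsum (L @ L')) *\<^sub>R
           F (L @ L') (g # R @ R')) hs
      = ksgn (fst g * degsum L) *\<^sub>R unsh_sum (\<lambda>L' R'. ksgn (degsum (g # R) * degsum L') *\<^sub>R
           F (L @ L') ((g # R) @ R')) hs" for L R
    unfolding unsh_sum_scaleR[symmetric] by (rule unsh_sum_cong) (auto simp: ksgn_def distrib_left distrib_right)
  then show ?case
    by (simp add: Cons.IH)
qed simp

text \<open>An unshuffle and its complement occur in the same sum, so the blocks may exchange roles
  at the cost of the sign of moving one past the other.\<close>

lemma unsh_sum_swap: "unsh_sum F gs = unsh_sum (\<lambda>L R. ksgn (degsum L * degsum R) *\<^sub>R F R L) gs"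
proof (induction gs arbitrary: F)
  case (Cons g gs)
  show ?case
    unfolding unsh_sum.simps
    by (subst (1 2) Cons.IH, subst add.commute, intro arg_cong2[of _ _ _ _ plus] unsh_sum_cong)
       (auto simp: ksgn_def)
qed simp

lemma unsh_sum_map:
  assumes "\<And>g. fst (f g) = fst g"
  shows "unsh_sum F (map f gs) = unsh_sum (\<lambda>L R. F (map f L) (map f R)) gs"
proof -
  have "degsum (map f hs) = degsum hs" for hs
    using assms by (induction hs) auto
  then show ?thesis
    using assms by (induction gs arbitrary: F) auto
qed

text \<open>Isolates the unshuffle that leaves the second block empty, which carries sign 1; the
  induction that proves coherence rests on it.\<close>

lemma unsh_sum_eq_single:
  assumes "\<And>L R. R \<noteq> [] \<Longrightarrow> mset L + mset R = mset gs \<Longrightarrow> F L R = 0"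
  shows "unsh_sum F gs = F gs []"
  using assms
proof (induction gs arbitrary: F)
  case (Cons g gs)
  have "unsh_sum (\<lambda>L R. ksgn (fst g * degsum L) *\<^sub>R F L (g # R)) gs = unsh_sum (\<lambda>L R. 0) gs"
    by (rule unsh_sum_cong) (simp add: Cons.prems)
  moreover have "unsh_sum (\<lambda>L R. F (g # L) R) gs = F (g # gs) []"
    by (rule Cons.IH) (simp add: Cons.prems)
  ultimately show ?case by simp
qed simp

text \<open>The last letter of the word never lies in \<open>T\<close>, since the inner block closes
  at or before it. The fact is kept because a final letter from E is what makes terms vanish
  later.\<close>

lemma zinb_sum_cong:
  assumes "\<And>T S r. S \<noteq> [] \<Longrightarrow> mset T + mset S + mset r = mset gs \<Longrightarrow> last (S @ r) = last gs
      \<Longrightarrow> G T S r = G' T S r"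
  shows "zinb_sum G gs = zinb_sum G' gs"
  using assms
proof (induction gs arbitrary: G G')
  case (Cons g gs)
  have "zinb_sum (\<lambda>T S r. G (g # T) S r) gs = zinb_sum (\<lambda>T S r. G' (g # T) S r) gs"
    by (rule Cons.IH) (cases gs, auto intro!: Cons.prems)
  moreover have "zinb_sum (\<lambda>T S r. ksgn (fst g * degsum T) *\<^sub>R G T (g # S) r) gs
      = zinb_sum (\<lambda>T S r. ksgn (fst g * degsum T) *\<^sub>R G' T (g # S) r) gs"
    by (rule Cons.IH) (cases gs, auto intro!: Cons.prems)
  moreover have "G [] [g] gs = G' [] [g] gs"
    by (rule Cons.prems) auto
  ultimately show ?case by simp
qed simp

lemma zinb_sum_scaleR: "zinb_sum (\<lambda>T S r. c *\<^sub>R G T S r) gs = c *\<^sub>R zinb_sum G gs"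
proof (induction gs arbitrary: G)
  case (Cons g gs)
  show ?case
    using Cons.IH[of "\<lambda>T S r. G (g # T) S r"]
      Cons.IH[of "\<lambda>T S r. ksgn (fst g * degsum T) *\<^sub>R G T (g # S) r"]
    by (simp add: scaleR_right_distrib mult.commute)
qed simp

lemma zinb_sum_add: "zinb_sum (\<lambda>T S r. G T S r + G' T S r) gs = zinb_sum G gs + zinb_sum G' gs"
  by (induction gs arbitrary: G G') (simp_all add: scaleR_right_distrib)

lemma zinb_sum_0 [simp]: "zinb_sum (\<lambda>T S r. 0) gs = 0"
  by (induction gs) simp_all

lemma fst_zinb_sum: "fst (zinb_sum G gs) = zinb_sum (\<lambda>T S r. fst (G T S r)) gs"
  by (induction gs arbitrary: G) simp_all

lemma snd_zinb_sum: "snd (zinb_sum G gs) = zinb_sum (\<lambda>T S r. snd (G T S r)) gs"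
  by (induction gs arbitrary: G) simp_all

text \<open>The inner block closes either inside \<open>gs\<close>, leaving all of \<open>hs\<close>
  in the tail, or inside \<open>hs\<close>, and then \<open>gs\<close> is merely unshuffled between
  the outer prefix and the inner inputs.\<close>

lemma zinb_sum_append:
  "zinb_sum G (gs @ hs) = zinb_sum (\<lambda>T S r. G T S (r @ hs)) gs
     + unsh_sum (\<lambda>T R. zinb_sum (\<lambda>T' S r. ksgn (degsum R * degsum T') *\<^sub>R G (T @ T') (R @ S) r) hs) gs"
proof (induction gs arbitrary: G)
  case (Cons g gs)
  have "zinb_sum (\<lambda>T' S r. ksgn (degsum R * degsum T') *\<^sub>R ksgn (fst g * degsum (T @ T')) *\<^sub>R
           G (T @ T') (g # R @ S) r) hs
      = ksgn (fst g * degsum T) *\<^sub>R zinb_sum (\<lambda>T' S r. ksgn (degsum (g # R) * degsum T') *\<^sub>R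
           G (T @ T') ((g # R) @ S) r) hs" for T R
    unfolding zinb_sum_scaleR[symmetric] by (rule zinb_sum_cong) (auto simp: ksgn_def distrib_left distrib_right)
  then show ?case
    by (simp add: Cons.IH)
qed simp

lemma zinb_sum_map:
  assumes "\<And>g. fst (f g) = fst g"
  shows "zinb_sum G (map f gs) = zinb_sum (\<lambda>T S r. G (map f T) (map f S) (map f r)) gs"
proof -
  have "degsum (map f hs) = degsum hs" for hs
    using assms by (induction hs) auto
  then show ?thesis
    using assms by (induction gs arbitrary: G) auto
qed

text \<open>Unshuffles with nonempty first block are classified by the last element of that block, which
  is the last input of the inner bracket in the Zinbiel formula.\<close>

lemma zinb_sum_eq_unsh_sum:
  "zinb_sum (\<lambda>T S r. ksgn (degsum T * degsum S) *\<^sub>R F S (T @ r)) gs = unsh_sum F gs - F [] gs"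
proof (induction gs arbitrary: F)
  case (Cons g gs)
  have "zinb_sum (\<lambda>T S r. ksgn (degsum (g # T) * degsum S) *\<^sub>R F S ((g # T) @ r)) gs
     = zinb_sum (\<lambda>T S r. ksgn (degsum T * degsum S) *\<^sub>R ksgn (fst g * degsum S) *\<^sub>R F S (g # T @ r)) gs"
    by (rule zinb_sum_cong) (auto simp: ksgn_def distrib_left distrib_right)
  also have "\<dots> = unsh_sum (\<lambda>L R. ksgn (fst g * degsum L) *\<^sub>R F L (g # R)) gs - F [] (g # gs)"
    using Cons.IH[of "\<lambda>L R. ksgn (fst g * degsum L) *\<^sub>R F L (g # R)"] by simp
  finally have 1: "zinb_sum (\<lambda>T S r. ksgn (degsum (g # T) * degsum S) *\<^sub>R F S ((g # T) @ r)) gs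
     = unsh_sum (\<lambda>L R. ksgn (fst g * degsum L) *\<^sub>R F L (g # R)) gs - F [] (g # gs)" .
  have "zinb_sum (\<lambda>T S r. ksgn (fst g * degsum T) *\<^sub>R ksgn (degsum T * degsum (g # S)) *\<^sub>R F (g # S) (T @ r)) gs
     = zinb_sum (\<lambda>T S r. ksgn (degsum T * degsum S) *\<^sub>R F (g # S) (T @ r)) gs"
    by (rule zinb_sum_cong) (auto simp: ksgn_def distrib_left distrib_right)
  with 1 show ?case
    using Cons.IH[of "\<lambda>L R. F (g # L) R"] by simp
qed simp

section \<open>From sums over sets of positions to the recursive sums\<close>

lemma ksgn_add: "ksgn (a + b) = ksgn a * ksgn b"
  by (simp add: ksgn_def)

lemma degsum_nths: "degsum (nths gs S) = (\<Sum>a<length gs. if a \<in> S then fst (gs ! a) else 0)"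
proof (induction gs arbitrary: S)
  case (Cons g gs)
  show ?case
    by (simp add: nths_Cons Cons.IH sum.lessThan_Suc_shift del: sum.lessThan_Suc cong: if_cong)
qed simp

lemma ksign_Cons_insert: "ksign (d # ds) (insert 0 (Suc ` S)) = ksign ds S"
  by (simp add: ksign_def sum.lessThan_Suc_shift inj_image_mem_iff del: sum.lessThan_Suc cong: if_cong)

lemma ksign_Cons_Suc:
  "ksign (map fst (g # gs)) (Suc ` S) = ksgn (fst g * degsum (nths gs S)) * ksign (map fst gs) S"
proof -
  have "(\<Sum>a<length gs. \<Sum>b<Suc a. if Suc a \<in> Suc ` S \<and> b \<notin> Suc ` S
           then map fst (g # gs) ! Suc a * map fst (g # gs) ! b else 0)
     = (\<Sum>a<length gs. (if a \<in> S then fst (gs ! a) * fst g else 0)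
         + (\<Sum>b<a. if a \<in> S \<and> b \<notin> S then map fst gs ! a * map fst gs ! b else 0))"
    by (intro sum.cong refl)
       (auto simp: sum.lessThan_Suc_shift inj_image_mem_iff simp del: sum.lessThan_Suc cong: if_cong)
  also have "\<dots> = fst g * degsum (nths gs S)
      + (\<Sum>a<length gs. \<Sum>b<a. if a \<in> S \<and> b \<notin> S then map fst gs ! a * map fst gs ! b else 0)"
    unfolding degsum_nths sum.distrib sum_distrib_left
    by (intro arg_cong2[of _ _ _ _ plus] sum.cong refl) auto
  finally have *: "(\<Sum>a<length gs. \<Sum>b<Suc a. if Suc a \<in> Suc ` S \<and> b \<notin> Suc ` S
           then map fst (g # gs) ! Suc a * map fst (g # gs) ! b else 0) = \<dots>" .
  have "length (map fst (g # gs)) = Suc (length gs)"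
    by simp
  then show ?thesis
    unfolding ksign_def by (simp only: sum.lessThan_Suc_shift[of _ "length gs"] * ksgn_add) simp
qed

lemma Pow_atLeast0LessThan_Suc:
  "Pow {0..<Suc n} = (\<lambda>S. insert 0 (Suc ` S)) ` Pow {0..<n} \<union> (`) Suc ` Pow {0..<n}"
proof -
  have "{0..<Suc n} = insert 0 (Suc ` {0..<n})"
    by (simp add: atLeast0_lessThan_Suc_eq_insert_0)
  then show ?thesis
    by (simp add: Pow_insert image_Pow_surj[OF refl, symmetric] image_image Un_commute
        del: image_Suc_atLeastLessThan)
qed

text \<open>Subsets of positions split by whether they contain 0, which matches the two summands in
  the recursion for \<open>unsh_sum\<close>.\<close>

lemma sum_Pow_ksign:
  "(\<Sum>S\<in>Pow {0..<length gs}. ksign (map fst gs) S *\<^sub>R F (nths gs S) (nths gs (- S))) = unsh_sum F gs"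
proof (induction gs arbitrary: F)
  case Nil
  show ?case by (simp add: ksign_def)
next
  case (Cons g gs)
  let ?P = "Pow {0..<length gs}"
  let ?f = "\<lambda>S. ksign (map fst (g # gs)) S *\<^sub>R F (nths (g # gs) S) (nths (g # gs) (- S))"
  have inj: "inj_on (\<lambda>S. insert 0 (Suc ` S)) ?P" "inj_on ((`) Suc) ?P"
    by (auto simp: inj_on_def)
  have "sum ?f (Pow {0..<length (g # gs)})
      = (\<Sum>S\<in>?P. ?f (insert 0 (Suc ` S))) + (\<Sum>S\<in>?P. ?f (Suc ` S))"
    unfolding length_Cons Pow_atLeast0LessThan_Suc
    by (subst sum.union_disjoint) (auto simp: sum.reindex[OF inj(1)] sum.reindex[OF inj(2)])
  also have "(\<Sum>S\<in>?P. ?f (insert 0 (Suc ` S))) = unsh_sum (\<lambda>L R. F (g # L) R) gs"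
    unfolding Cons.IH[symmetric] list.map(2) ksign_Cons_insert
    by (simp add: nths_Cons inj_image_mem_iff Compl_eq)
  also have "(\<Sum>S\<in>?P. ?f (Suc ` S)) = unsh_sum (\<lambda>L R. ksgn (fst g * degsum L) *\<^sub>R F L (g # R)) gs"
    unfolding Cons.IH[symmetric] ksign_Cons_Suc
    by (simp add: nths_Cons inj_image_mem_iff Compl_eq mult.commute)
  finally show ?case by simp
qed

lemma sum_nsubs_ksign:
  "(\<Sum>S\<in>nsubs (length gs). ksign (map fst gs) S *\<^sub>R F (nths gs S) (nths gs (- S)))
     = unsh_sum F gs - F [] gs"
  unfolding nsubs_def sum_Pow_ksign[symmetric]
  by (subst sum_diff) (auto simp: ksign_def nths_all)

lemma nths_all_but: "nths gs (- {0..<length gs}) = []"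
  by (rule ccontr) (auto simp: nths_def filter_empty_conv set_zip)

lemma ksign_all: "ksign ds {0..<length ds} = 1"
proof -
  have "(\<Sum>b<a. if a \<in> {0..<length ds} \<and> b \<notin> {0..<length ds} then ds ! a * ds ! b else 0) = 0"
    if "a < length ds" for a
    using that by (intro sum.neutral) auto
  then show ?thesis
    unfolding ksign_def by simp
qed

lemma sum_proper_nsubs_ksign:
  assumes "gs \<noteq> []"
  shows "(\<Sum>S\<in>nsubs (length gs) - {{0..<length gs}}.
           ksign (map fst gs) S *\<^sub>R F (nths gs S) (nths gs (- S)))
     = unsh_sum F gs - F [] gs - F gs []"
proof -
  have "{0..<length gs} \<in> nsubs (length gs)" "finite (nsubs (length gs))"
    using assms by (auto simp: nsubs_def)
  then show ?thesis
    unfolding sum_nsubs_ksign[symmetric]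
    using ksign_all[of "map fst gs"]
    by (subst sum_diff1) (auto simp: nths_all nths_all_but)
qed

text \<open>\<open>p []\<close> is an artefact of the list encoding: \<open>nsubs\<close> leaves out
  the empty block, whereas \<open>unsh_sum\<close> includes it, hence the correction.\<close>

lemma cmp_eq_unsh_sum:
  "cmp q p gs = unsh_sum (\<lambda>S R. q (p (vals S) # vals R)) gs - q (p [] # vals gs)"
  unfolding cmp_def using sum_nsubs_ksign[of gs "\<lambda>S R. q (p (vals S) # vals R)"] by simp

text \<open>The index \<open>j\<close> is the position at which the inner block closes; the letters
  before it are unshuffled, those after it form the tail.\<close>

lemma sum_zinb_sum:
  "(\<Sum>j<length gs. unsh_sum (\<lambda>T S. G T (S @ [gs ! j]) (drop (Suc j) gs)) (take j gs)) = zinb_sum G gs"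
proof (induction gs arbitrary: G)
  case (Cons g gs)
  show ?case
    by (simp add: sum.lessThan_Suc_shift sum.distrib
        Cons.IH[of "\<lambda>T S r. G (g # T) S r"]
        Cons.IH[of "\<lambda>T S r. ksgn (fst g * degsum T) *\<^sub>R G T (g # S) r"] del: sum.lessThan_Suc)
qed simp

lemma zcmp_eq_zinb_sum:
  "zcmp q dp p gs = zinb_sum (\<lambda>T S r. ksgn (dp * degsum T) *\<^sub>R q (vals T @ p (vals S) # vals r)) gs"
proof -
  have "(\<Sum>T\<in>Pow {0..<j}. (ksgn (dp * degsum (nths (take j gs) T)) * ksign (map fst (take j gs)) T) *\<^sub>R
      q (vals (nths (take j gs) T) @ [p (vals (nths (take j gs) (- T)) @ [snd (gs ! j)])]
         @ vals (drop (Suc j) gs)))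
    = unsh_sum (\<lambda>T S. ksgn (dp * degsum T) *\<^sub>R q (vals T @ p (vals (S @ [gs ! j])) # vals (drop (Suc j) gs)))
        (take j gs)" if "j < length gs" for j
    unfolding sum_Pow_ksign[symmetric] using that by (simp add: mult.commute min_def)
  then show ?thesis
    unfolding zcmp_def sum_zinb_sum[symmetric] by simp
qed

section \<open>Multilinear and graded symmetric maps\<close>

lemma multilinear_add: "multilinear f \<Longrightarrow> f (A @ (a + b) # B) = f (A @ a # B) + f (A @ b # B)"
  by (simp add: multilinear_def)

lemma multilinear_zero:
  assumes "multilinear f"
  shows "f (A @ 0 # B) = 0"
proof -
  have "f (A @ (0 *\<^sub>R 0) # B) = 0 *\<^sub>R f (A @ 0 # B)"
    using assms unfolding multilinear_def by blast
  then show ?thesis by simp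
qed

text \<open>Composes adjacent transpositions, \<open>b\<close> passing the letters of
  \<open>T\<close> from right to left.\<close>

lemma graded_symmetric_move:
  assumes "graded_symmetric H q" "hom H (T @ b # r)"
  shows "q (vals (T @ b # r)) = ksgn (degsum T * fst b) *\<^sub>R q (vals (b # T @ r))"
  using assms(2)
proof (induction T arbitrary: r rule: rev_induct)
  case (snoc t T)
  have "q (vals ((T @ [t]) @ b # r)) = ksgn (fst t * fst b) *\<^sub>R q (vals (T @ b # t # r))"
    using assms(1) snoc.prems unfolding graded_symmetric_def
    by (metis append.assoc append_Cons append_Nil)
  also have "\<dots> = ksgn (fst t * fst b) *\<^sub>R ksgn (degsum T * fst b) *\<^sub>R q (vals (b # T @ t # r))"
    using snoc.prems by (subst snoc.IH) auto
  finally show ?case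
    by (auto simp: ksgn_def distrib_right)
qed simp

text \<open>Graded symmetry lets the value of \<open>p\<close> move to the front past
  \<open>T\<close>, with sign exponent \<open>degsum T * (degsum S + dp)\<close>. The part with
  \<open>dp\<close> cancels the sign of the Zinbiel formula and the rest exchanges the blocks
  \<open>T\<close> and \<open>S\<close>, so the sum becomes one over ordinary unshuffles.\<close>

lemma zinb_sum_eq_unsh_sum_insertion:
  assumes q: "graded_symmetric H q" and gs: "hom H gs"
    and p: "\<And>S. S \<noteq> [] \<Longrightarrow> hom H S \<Longrightarrow> p (vals S) \<in> H (degsum S + dp)"
  shows "zinb_sum (\<lambda>T S r. ksgn (dp * degsum T) *\<^sub>R q (vals T @ p (vals S) # vals r)) gs
    = unsh_sum (\<lambda>S R. q (p (vals S) # vals R)) gs - q (p [] # vals gs)"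
proof -
  have "zinb_sum (\<lambda>T S r. ksgn (dp * degsum T) *\<^sub>R q (vals T @ p (vals S) # vals r)) gs
     = zinb_sum (\<lambda>T S r. ksgn (degsum T * degsum S) *\<^sub>R q (p (vals S) # vals (T @ r))) gs"
  proof (rule zinb_sum_cong)
    fix T S r assume S: "S \<noteq> []" and mset: "mset T + mset S + mset r = mset gs"
    from mset have "set T \<union> set S \<union> set r = set gs"
      by (metis set_mset_mset set_mset_union)
    with gs have h: "hom H T" "hom H S" "hom H r"
      by (auto intro: hom_subset)
    have "q (vals (T @ (degsum S + dp, p (vals S)) # r))
        = ksgn (degsum T * (degsum S + dp)) *\<^sub>R q (vals ((degsum S + dp, p (vals S)) # T @ r))"
      using graded_symmetric_move[OF q, of T "(degsum S + dp, p (vals S))" r] h p[OF S h(2)] by simp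
    then show "ksgn (dp * degsum T) *\<^sub>R q (vals T @ p (vals S) # vals r)
        = ksgn (degsum T * degsum S) *\<^sub>R q (p (vals S) # vals (T @ r))"
      by (auto simp: ksgn_def distrib_left)
  qed
  then show ?thesis
    using zinb_sum_eq_unsh_sum[of "\<lambda>S R. q (p (vals S) # vals R)" gs] by simp
qed

lemma zinb_sum_eq_cmp:
  assumes "graded_symmetric H q" "hom H gs"
    and "\<And>S. S \<noteq> [] \<Longrightarrow> hom H S \<Longrightarrow> p (vals S) \<in> H (degsum S + dp)"
  shows "zinb_sum (\<lambda>T S r. ksgn (dp * degsum T) *\<^sub>R q (vals T @ p (vals S) # vals r)) gs = cmp q p gs"
  unfolding cmp_eq_unsh_sum by (rule zinb_sum_eq_unsh_sum_insertion[OF assms])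

lemma sum_proper_nsubs_cong:
  assumes "\<And>L R. L \<noteq> [] \<Longrightarrow> R \<noteq> [] \<Longrightarrow> F L R = F' L R"
  shows "(\<Sum>S\<in>nsubs (length gs) - {{0..<length gs}}.
           ksign (map fst gs) S *\<^sub>R F (nths gs S) (nths gs (- S)))
    = (\<Sum>S\<in>nsubs (length gs) - {{0..<length gs}}.
           ksign (map fst gs) S *\<^sub>R F' (nths gs S) (nths gs (- S)))"
proof (rule sum.cong[OF refl])
  fix S assume "S \<in> nsubs (length gs) - {{0..<length gs}}"
  then have S: "S \<subseteq> {0..<length gs}" "S \<noteq> {}" "S \<noteq> {0..<length gs}"
    by (auto simp: nsubs_def)
  then obtain i j where "i \<in> S" "i < length gs" "j \<notin> S" "j < length gs"
    by fastforce
  then have "gs ! i \<in> set (nths gs S)" "gs ! j \<in> set (nths gs (- S))"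
    unfolding set_nths by blast+
  then have "nths gs S \<noteq> []" "nths gs (- S) \<noteq> []"
    by auto
  then show "ksign (map fst gs) S *\<^sub>R F (nths gs S) (nths gs (- S))
      = ksign (map fst gs) S *\<^sub>R F' (nths gs S) (nths gs (- S))"
    using assms by auto
qed

text \<open>Both summands carry the same degree tag, so Koszul signs are unaffected. This is the
  property by which a letter \<open>(e, v)\<close> is split into \<open>(e, 0)\<close> and
  \<open>(0, v)\<close>.\<close>

definition slot_additive :: "((int \<times> 'a::plus) list \<Rightarrow> 'w::real_vector) \<Rightarrow> bool" where
  "slot_additive f \<longleftrightarrow>
     (\<forall>A B d a b. f (A @ (d, a + b) # B) = f (A @ (d, a) # B) + f (A @ (d, b) # B))"

lemma zinb_sum_slot_additive:
  assumes "\<And>S r. slot_additive (\<lambda>T. G T S r)" "\<And>T r. slot_additive (\<lambda>S. G T S r)"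
    and "\<And>T S. slot_additive (G T S)"
  shows "slot_additive (zinb_sum G)"
proof -
  have "zinb_sum G (A @ (d, a + b) # B) = zinb_sum G (A @ (d, a) # B) + zinb_sum G (A @ (d, b) # B)" for A B d a b
    using assms
  proof (induction A arbitrary: G)
    case Nil
    have 1: "G ((d, a + b) # T) S r = G ((d, a) # T) S r + G ((d, b) # T) S r" for T S r
      using Nil(1)[of S r] unfolding slot_additive_def by (metis append_Nil)
    have 2: "G T ((d, a + b) # S) r = G T ((d, a) # S) r + G T ((d, b) # S) r" for T S r
      using Nil(2)[of T r] unfolding slot_additive_def by (metis append_Nil)
    show ?case
      by (simp add: 1 2 zinb_sum_add scaleR_right_distrib)
  next
    case (Cons c A)
    let ?G1 = "\<lambda>T S r. G (c # T) S r"
    let ?G2 = "\<lambda>T S r. ksgn (fst c * degsum T) *\<^sub>R G T (c # S) r"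
    have *: "f (c # xs @ (d, a + b) # ys) = f (c # xs @ (d, a) # ys) + f (c # xs @ (d, b) # ys)"
      if "slot_additive f" for f :: "(int \<times> 'a) list \<Rightarrow> 'b" and xs d a b ys
      using that unfolding slot_additive_def by (metis append_Cons)
    have "zinb_sum ?G1 (A @ (d, a + b) # B) = zinb_sum ?G1 (A @ (d, a) # B) + zinb_sum ?G1 (A @ (d, b) # B)"
      by (rule Cons.IH) (use Cons.prems *[OF Cons.prems(1)] in \<open>simp_all add: slot_additive_def\<close>)
    moreover have "zinb_sum ?G2 (A @ (d, a + b) # B) = zinb_sum ?G2 (A @ (d, a) # B) + zinb_sum ?G2 (A @ (d, b) # B)"
      by (rule Cons.IH)
        (use Cons.prems *[OF Cons.prems(2)] in \<open>simp_all add: slot_additive_def scaleR_right_distrib\<close>)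
    moreover have "G [] [c] (A @ (d, a + b) # B) = G [] [c] (A @ (d, a) # B) + G [] [c] (A @ (d, b) # B)"
      using Cons.prems(3) by (simp add: slot_additive_def)
    ultimately show ?case
      by simp
  qed
  then show ?thesis
    by (simp add: slot_additive_def)
qed

lemma zcmp_slot_additive:
  assumes q: "multilinear q" and p: "multilinear p"
  shows "slot_additive (zcmp q dp p)"
proof -
  have "slot_additive (zinb_sum (\<lambda>T S r. ksgn (dp * degsum T) *\<^sub>R q (vals T @ p (vals S) # vals r)))"
  proof (rule zinb_sum_slot_additive)
    show "slot_additive (\<lambda>T. ksgn (dp * degsum T) *\<^sub>R q (vals T @ p (vals S) # vals r))" for S r
      by (simp add: slot_additive_def multilinear_add[OF q] scaleR_right_distrib)
    show "slot_additive (\<lambda>S. ksgn (dp * degsum T) *\<^sub>R q (vals T @ p (vals S) # vals r))" for T r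
      by (simp add: slot_additive_def multilinear_add[OF q] multilinear_add[OF p] scaleR_right_distrib)
    show "slot_additive (\<lambda>r. ksgn (dp * degsum T) *\<^sub>R q (vals T @ p (vals S) # vals r))" for T S
    proof -
      have "q (vals T @ x # vals A @ (a + b) # vals B)
         = q (vals T @ x # vals A @ a # vals B) + q (vals T @ x # vals A @ b # vals B)" for x A a b B
        using multilinear_add[OF q, of "vals T @ x # vals A"] by simp
      then show ?thesis
        by (simp add: slot_additive_def scaleR_right_distrib)
    qed
  qed
  moreover have "zcmp q dp p = zinb_sum (\<lambda>T S r. ksgn (dp * degsum T) *\<^sub>R q (vals T @ p (vals S) # vals r))"
    by (rule ext) (rule zcmp_eq_zinb_sum)
  ultimately show ?thesis
    by simp
qed

lemma multilinear_zero_mem: "multilinear f \<Longrightarrow> 0 \<in> set ws \<Longrightarrow> f ws = 0"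
  by (metis multilinear_zero split_list)

section \<open>Words with letters in \<open>E\<close> and \<open>V\<close>\<close>

definition inE :: "int \<times> 'e \<Rightarrow> int \<times> ('e \<times> 'v::zero)" where
  "inE g = (fst g, (snd g, 0))"

definition inV :: "int \<times> 'v \<Rightarrow> int \<times> ('e::zero \<times> 'v)" where
  "inV g = (fst g, (0, snd g))"

lemma fst_in [simp]: "fst (inE g) = fst g" "fst (inV g) = fst g"
  by (simp_all add: inE_def inV_def)

lemma degsum_map_in [simp]: "degsum (map inE gs) = degsum gs" "degsum (map inV gs) = degsum gs"
  by (induction gs) simp_all

lemma vals_map_in [simp]:
  "vals (map inE gs) = map (\<lambda>e. (e, 0)) (vals gs)" "vals (map inV gs) = map (\<lambda>v. (0, v)) (vals gs)"
  by (simp_all add: vals_def inE_def inV_def)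

definition pure :: "(int \<Rightarrow> 'e::zero set) \<Rightarrow> (int \<Rightarrow> 'v::zero set) \<Rightarrow> (int \<times> ('e \<times> 'v)) list \<Rightarrow> bool" where
  "pure HE HV W \<longleftrightarrow>
     (\<forall>g\<in>set W. (\<exists>x. g = inE x \<and> snd x \<in> HE (fst x)) \<or> (\<exists>v. g = inV v \<and> snd v \<in> HV (fst v)))"

lemma pure_simps [simp]:
  "pure HE HV []"
  "pure HE HV (g # W) \<longleftrightarrow> ((\<exists>x. g = inE x \<and> snd x \<in> HE (fst x)) \<or> (\<exists>v. g = inV v \<and> snd v \<in> HV (fst v)))
     \<and> pure HE HV W"
  "pure HE HV (W @ W') \<longleftrightarrow> pure HE HV W \<and> pure HE HV W'"
  by (auto simp: pure_def)

lemma pure_map_in: "hom HE xs \<Longrightarrow> pure HE HV (map inE xs)"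
  by (induction xs) fastforce+

text \<open>Letters are split one at a time from the left; in the induction \<open>A\<close> is the
  prefix already split.\<close>

lemma slot_additive_eq_zeroI:
  fixes f :: "(int \<times> ('e::real_vector \<times> 'v::real_vector)) list \<Rightarrow> 'w::real_vector"
  assumes f: "slot_additive f" and pure: "\<And>W. W \<noteq> [] \<Longrightarrow> pure HE HV W \<Longrightarrow> f W = 0"
    and gs: "hom (\<lambda>d. HE d \<times> HV d) gs" "gs \<noteq> []"
  shows "f gs = 0"
proof -
  have "f (A @ gs) = 0" if "pure HE HV A" "A @ gs \<noteq> []" for A
    using gs(1) that
  proof (induction gs arbitrary: A)
    case (Cons g gs)
    obtain d e v where g: "g = (d, (e, v))"
      by (cases g) auto
    have split: "f (A @ g # gs) = f ((A @ [inE (d, e)]) @ gs) + f ((A @ [inV (d, v)]) @ gs)"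
      using f[unfolded slot_additive_def, rule_format, of A d "(e, 0)" "(0, v)" gs]
      by (simp add: g inE_def inV_def)
    have "pure HE HV (A @ [inE (d, e)])" "pure HE HV (A @ [inV (d, v)])" "hom (\<lambda>d. HE d \<times> HV d) gs"
      using Cons.prems by (auto simp: g)
    then show ?case
      unfolding split by (simp add: Cons.IH del: append_assoc)
  qed (use pure in auto)
  from this[of "[]"] gs(2) show ?thesis
    by simp
qed

text \<open>A word that is not sorted is cut at its first letter from V and at its last letter from
  E; between the two, \<open>M\<close> is arbitrary.\<close>

lemma pure_cases:
  assumes "pure HE HV W"
  obtains (sorted) xs vs where "W = map inE xs @ map inV vs" "hom HE xs" "hom HV vs"
  | (mixed) xs v M y vs where "W = map inE xs @ (inV v # M @ [inE y]) @ map inV vs"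
      "hom HE xs" "snd v \<in> HV (fst v)" "pure HE HV M" "snd y \<in> HE (fst y)" "hom HV vs"
proof -
  have "(\<exists>xs vs. W = map inE xs @ map inV vs \<and> hom HE xs \<and> hom HV vs)
    \<or> (\<exists>xs v M y vs. W = map inE xs @ (inV v # M @ [inE y]) @ map inV vs
        \<and> hom HE xs \<and> snd v \<in> HV (fst v) \<and> pure HE HV M \<and> snd y \<in> HE (fst y) \<and> hom HV vs)"
    (is "?S W \<or> ?M W")
    using assms
  proof (induction W)
    case Nil
    have "[] = map inE [] @ map inV [] \<and> hom HE [] \<and> hom HV []"
      by simp
    then show ?case by blast
  next
    case (Cons g W)
    then have IH: "?S W \<or> ?M W"
      by simp
    from Cons.prems consider (E) x where "g = inE x" "snd x \<in> HE (fst x)"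
      | (V) v where "g = inV v" "snd v \<in> HV (fst v)"
      by auto
    then show ?case
    proof cases
      case E
      from IH show ?thesis
      proof
        assume "?S W"
        then obtain xs vs where "W = map inE xs @ map inV vs" "hom HE xs" "hom HV vs"
          by blast
        with E have "g # W = map inE (x # xs) @ map inV vs \<and> hom HE (x # xs) \<and> hom HV vs"
          by simp
        then show ?thesis by blast
      next
        assume "?M W"
        then obtain xs v M y vs where "W = map inE xs @ (inV v # M @ [inE y]) @ map inV vs"
          "hom HE xs" "snd v \<in> HV (fst v)" "pure HE HV M" "snd y \<in> HE (fst y)" "hom HV vs"
          by blast
        with E have "g # W = map inE (x # xs) @ (inV v # M @ [inE y]) @ map inV vs
          \<and> hom HE (x # xs) \<and> snd v \<in> HV (fst v) \<and> pure HE HV M \<and> snd y \<in> HE (fst y) \<and> hom HV vs"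
          by simp
        then show ?thesis by blast
      qed
    next
      case V
      from IH show ?thesis
      proof
        assume "?S W"
        then obtain xs vs where W: "W = map inE xs @ map inV vs" "hom HE xs" "hom HV vs"
          by blast
        show ?thesis
        proof (cases xs rule: rev_cases)
          case Nil
          with W V have "g # W = map inE [] @ map inV (v # vs) \<and> hom HE [] \<and> hom HV (v # vs)"
            by simp
          then show ?thesis by blast
        next
          case (snoc xs' y)
          have "pure HE HV (map inE xs')"
            using W(2) snoc by (simp add: pure_map_in)
          with W V snoc have "g # W = map inE [] @ (inV v # map inE xs' @ [inE y]) @ map inV vs
            \<and> hom HE [] \<and> snd v \<in> HV (fst v) \<and> pure HE HV (map inE xs') \<and> snd y \<in> HE (fst y) \<and> hom HV vs"
            by simp
          then show ?thesis by blast
        qed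
      next
        assume "?M W"
        then obtain xs v' M y vs where W: "W = map inE xs @ (inV v' # M @ [inE y]) @ map inV vs"
          "hom HE xs" "snd v' \<in> HV (fst v')" "pure HE HV M" "snd y \<in> HE (fst y)" "hom HV vs"
          by blast
        have "pure HE HV (map inE xs)"
          using W(2) by (rule pure_map_in)
        with W V have "g # W = map inE [] @ (inV v # (map inE xs @ inV v' # M) @ [inE y]) @ map inV vs
          \<and> hom HE [] \<and> snd v \<in> HV (fst v) \<and> pure HE HV (map inE xs @ inV v' # M)
          \<and> snd y \<in> HE (fst y) \<and> hom HV vs"
          by auto
        then show ?thesis by blast
      qed
    qed
  qed
  then show ?thesis
    using that by blast
qed

section \<open>Unshuffles that separate the letters of V from those of E\<close>

text \<open>\<open>sorting s M vs ys\<close>: moving the letters \<open>vs\<close> of the word \<open>M\<close> to the left of its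
  letters \<open>ys\<close> has Koszul sign \<open>s\<close>.\<close>

inductive sorting ::
  "real \<Rightarrow> (int \<times> ('e::zero \<times> 'v::zero)) list \<Rightarrow> (int \<times> 'v) list \<Rightarrow> (int \<times> 'e) list \<Rightarrow> bool" where
  "sorting 1 [] [] []"
| "sorting s M vs ys \<Longrightarrow> sorting s (inV v # M) (v # vs) ys"
| "sorting s M vs ys \<Longrightarrow> sorting (s * ksgn (fst y * degsum vs)) (inE y # M) vs (y # ys)"

lemma pure_sorting:
  assumes "pure HE HV M"
  obtains s vs ys where "sorting s M vs ys" "hom HV vs" "hom HE ys"
proof -
  have "\<exists>s vs ys. sorting s M vs ys \<and> hom HV vs \<and> hom HE ys"
    using assms
  proof (induction M)
    case Nil
    have "sorting 1 [] [] [] \<and> hom HV [] \<and> hom HE []"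
      by (simp add: sorting.intros)
    then show ?case by blast
  next
    case (Cons g M)
    then obtain s vs ys where IH: "sorting s M vs ys" "hom HV vs" "hom HE ys"
      by auto
    from Cons.prems consider (E) x where "g = inE x" "snd x \<in> HE (fst x)"
      | (V) v where "g = inV v" "snd v \<in> HV (fst v)"
      by auto
    then show ?case
    proof cases
      case E
      with IH have "sorting (s * ksgn (fst x * degsum vs)) (g # M) vs (x # ys) \<and> hom HV vs \<and> hom HE (x # ys)"
        by (simp add: sorting.intros)
      then show ?thesis by blast
    next
      case V
      with IH have "sorting s (g # M) (v # vs) ys \<and> hom HV (v # vs) \<and> hom HE ys"
        by (simp add: sorting.intros)
      then show ?thesis by blast
    qed
  qed
  then show ?thesis
    using that by blast
qed

lemma sorting_sorted: "sorting 1 (map inV vs @ map inE ys) vs ys"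
proof (induction vs)
  case Nil
  show ?case
  proof (induction ys)
    case (Cons y ys)
    then show ?case
      using sorting.intros(3)[of 1 "map inE ys" "[]" ys y] by simp
  qed (simp add: sorting.intros)
qed (simp add: sorting.intros)

text \<open>A single unshuffle survives: letters from V go to the first block, those from E to the
  second. Its Koszul sign is the sorting sign \<open>s\<close>.\<close>

lemma unsh_sum_sorting:
  assumes "sorting s M vs ys"
    and "\<And>L R a. inE a \<in> set L \<Longrightarrow> F L R = 0" "\<And>L R a. inV a \<in> set R \<Longrightarrow> F L R = 0"
  shows "unsh_sum F M = s *\<^sub>R F (map inV vs) (map inE ys)"
  using assms
proof (induction arbitrary: F rule: sorting.induct)
  case (2 s M vs ys v)
  have "unsh_sum (\<lambda>L R. F (inV v # L) R) M = s *\<^sub>R F (inV v # map inV vs) (map inE ys)"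
    by (rule "2.IH") (auto intro: "2.prems")
  moreover have "unsh_sum (\<lambda>L R. ksgn (fst (inV v) * degsum L) *\<^sub>R F L (inV v # R)) M = unsh_sum (\<lambda>L R. 0) M"
    by (rule unsh_sum_cong) (simp add: "2.prems"(2)[of v])
  ultimately show ?case
    by simp
next
  case (3 s M vs ys y)
  have "unsh_sum (\<lambda>L R. ksgn (fst y * degsum L) *\<^sub>R F L (inE y # R)) M
    = s *\<^sub>R ksgn (fst y * degsum vs) *\<^sub>R F (map inV vs) (inE y # map inE ys)"
    by (subst "3.IH") (auto intro: "3.prems")
  moreover have "unsh_sum (\<lambda>L R. F (inE y # L) R) M = unsh_sum (\<lambda>L R. 0) M"
    by (rule unsh_sum_cong) (simp add: "3.prems"(1)[of y])
  ultimately show ?case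
    by simp
qed simp

definition unsorted :: "(int \<times> ('e::zero \<times> 'v::zero)) list \<Rightarrow> bool" where
  "unsorted W \<longleftrightarrow> (\<exists>A v B y C. W = A @ inV v # B @ inE y # C)"

lemma unsortedI: "unsorted (A @ inV v # B @ inE y # C)"
  unfolding unsorted_def by blast

lemma unsorted_if_mem:
  assumes "inV v \<in> set A" "inE y \<in> set B"
  shows "unsorted (A @ B)"
proof -
  obtain A1 A2 B1 B2 where "A = A1 @ inV v # A2" "B = B1 @ inE y # B2"
    using assms by (meson split_list)
  then show ?thesis
    using unsortedI[of A1 v "A2 @ B1" y B2] by simp
qed

lemma unsorted_append1: "unsorted A \<Longrightarrow> unsorted (A @ B)"
  unfolding unsorted_def by (metis append.assoc append_Cons)

text \<open>The block containing \<open>v\<close> admits no letter from E, and the block containing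
  \<open>y\<close> none from V. So \<open>v\<close> and \<open>y\<close> lie in different blocks,
  which forces where every letter of \<open>M\<close> goes and leaves two unshuffles.\<close>

lemma unsh_sum_mixed:
  fixes v :: "int \<times> 'v::zero" and y :: "int \<times> 'e::zero"
  assumes M: "sorting s M vs ys" and F: "\<And>L R. unsorted L \<Longrightarrow> F L R = 0" "\<And>L R. unsorted R \<Longrightarrow> F L R = 0"
  defines "vs' \<equiv> v # vs" and "ys' \<equiv> ys @ [y]"
  shows "unsh_sum F (inV v # M @ [inE y]) = s *\<^sub>R (F (map inV vs') (map inE ys')
     + ksgn (degsum vs' * degsum ys') *\<^sub>R F (map inE ys') (map inV vs'))"
proof -
  have unsorted1: "unsorted (inV v # A @ [inE y])" for A
    using unsortedI[of "[]" v A y "[]"] by simp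
  have unsorted2: "unsorted (inV v # A)" if "inE a \<in> set A" for A a
    using unsorted_if_mem[of v "[inV v]" a A] that by simp
  have unsorted3: "unsorted (A @ [inE y])" if "inV a \<in> set A" for A a
    using unsorted_if_mem[of a A y "[inE y]"] that by simp
  have "unsh_sum (\<lambda>L R. F (inV v # L) R) (M @ [inE y]) = unsh_sum (\<lambda>L R. F (inV v # L) (R @ [inE y])) M"
    unfolding unsh_sum_append by (simp add: F(1)[OF unsorted1])
  also have "\<dots> = s *\<^sub>R F (map inV vs') (map inE ys')"
  proof -
    have "unsh_sum (\<lambda>L R. F (inV v # L) (R @ [inE y])) M = s *\<^sub>R F (inV v # map inV vs) (map inE ys @ [inE y])"
      by (rule unsh_sum_sorting[OF M]) (blast intro: F unsorted2 unsorted3)+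
    then show ?thesis
      by (simp add: vs'_def ys'_def)
  qed
  finally have 1: "unsh_sum (\<lambda>L R. F (inV v # L) R) (M @ [inE y]) = s *\<^sub>R F (map inV vs') (map inE ys')" .
  \<comment> \<open>Now \<open>v\<close> is in the second block. Exchanging the blocks of
    \<open>M\<close> brings this case back to \<open>unsh_sum_sorting\<close>, and the signs combine
    to \<open>ksgn (degsum vs' * degsum ys')\<close>.\<close>
  have "unsh_sum (\<lambda>L R. ksgn (fst v * degsum L) *\<^sub>R F L (inV v # R)) (M @ [inE y])
     = unsh_sum (\<lambda>L R. ksgn (degsum R * fst y) *\<^sub>R ksgn (fst v * (degsum L + fst y)) *\<^sub>R F (L @ [inE y]) (inV v # R)) M"
    unfolding unsh_sum_append by (simp add: F(2)[OF unsorted1])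
  also have "\<dots> = unsh_sum (\<lambda>L R. ksgn (degsum L * degsum R) *\<^sub>R ksgn (degsum L * fst y) *\<^sub>R
       ksgn (fst v * (degsum R + fst y)) *\<^sub>R F (R @ [inE y]) (inV v # L)) M"
    by (rule unsh_sum_swap)
  also have "\<dots> = s *\<^sub>R ksgn (degsum vs' * degsum ys') *\<^sub>R F (map inE ys') (map inV vs')"
  proof -
    have "F (R @ [inE y]) (inV v # L) = 0" if "inE a \<in> set L" for L R a
      using that by (blast intro: F unsorted2)
    moreover have "F (R @ [inE y]) (inV v # L) = 0" if "inV a \<in> set R" for L R a
      using that by (blast intro: F unsorted3)
    ultimately show ?thesis
      unfolding vs'_def ys'_def
      by (subst unsh_sum_sorting[OF M]) (auto simp: ksgn_def distrib_left distrib_right)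
  qed
  finally show ?thesis
    using 1 by (simp add: scaleR_right_distrib)
qed

section \<open>The semidirect brackets of an action\<close>

locale lie_infty_action_data =
  fixes HE :: "int \<Rightarrow> 'e::real_vector set" and HV :: "int \<Rightarrow> 'v::real_vector set"
    and l :: "'e list \<Rightarrow> 'e" and m :: "'v list \<Rightarrow> 'v" and \<Phi> :: "'e list \<Rightarrow> 'v list \<Rightarrow> 'v"
  assumes lie_E: "lie_infty HE l" and lie_V: "lie_infty HV m"
    and action: "lie_infty_action HE l HV m \<Phi>"
begin

abbreviation brackets :: "('e \<times> 'v) list \<Rightarrow> 'e \<times> 'v" where
  "brackets \<equiv> semidirect_brackets l \<Phi> m"

text \<open>Setting \<open>\<Phi> [] = m\<close> makes \<open>m\<close> and \<open>\<Phi>\<close>, as well as \<open>ad_v\<close> and \<open>\<Phi>_{y;v}\<close>, instances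
  of the same expressions.\<close>

definition act :: "'e list \<Rightarrow> 'v list \<Rightarrow> 'v" where
  "act xs = (if xs = [] then m else \<Phi> xs)"

lemma l_props: "multilinear l" "graded_symmetric HE l" "has_degree HE 1 l"
  and l_cmp: "\<And>gs. gs \<noteq> [] \<Longrightarrow> hom HE gs \<Longrightarrow> cmp l l gs = 0"
  using lie_E by (auto simp: lie_infty_def)

lemma m_props: "multilinear m" "graded_symmetric HV m" "has_degree HV 1 m"
  and m_cmp: "\<And>gs. gs \<noteq> [] \<Longrightarrow> hom HV gs \<Longrightarrow> cmp m m gs = 0"
  using lie_V by (auto simp: lie_infty_def)

lemma \<Phi>_props:
  "multilinear (\<lambda>xs. \<Phi> xs vs)" "multilinear (\<Phi> xs)"
  "graded_symmetric HE (\<lambda>xs. \<Phi> xs vs)" "graded_symmetric HV (\<Phi> xs)"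
  "xs' \<noteq> [] \<Longrightarrow> vs' \<noteq> [] \<Longrightarrow> hom HE xs' \<Longrightarrow> hom HV vs' \<Longrightarrow>
     \<Phi> (vals xs') (vals vs') \<in> HV (degsum xs' + degsum vs' + 1)"
  using action by (simp_all add: lie_infty_action_def)

lemma act_graded_symmetric: "graded_symmetric HV (act xs)"
  by (simp add: act_def m_props \<Phi>_props)

text \<open>Components of \<open>ad_v\<close> and \<open>\<Phi>_{y;v}\<close> are graded symmetric,
  so they can serve as outer map when Zinbiel and symmetric composites are compared.\<close>

lemma act_graded_symmetric_prefix:
  assumes "hom HV vs"
  shows "graded_symmetric HV (\<lambda>us. act xs (vals vs @ us))"
  unfolding graded_symmetric_def
proof (intro allI impI)
  fix us a b ws assume "hom HV (us @ a # b # ws)"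
  then have "hom HV ((vs @ us) @ a # b # ws)"
    using assms by simp
  then show "act xs (vals vs @ vals (us @ a # b # ws))
      = ksgn (fst a * fst b) *\<^sub>R act xs (vals vs @ vals (us @ b # a # ws))"
    using act_graded_symmetric[of xs] unfolding graded_symmetric_def
    by (metis append.assoc vals_simps(3))
qed

lemma act_degree:
  assumes "vs \<noteq> []" "hom HE xs" "hom HV vs"
  shows "act (vals xs) (vals vs) \<in> HV (degsum vs + (degsum xs + 1))"
proof (cases "xs = []")
  case True
  then show ?thesis
    using m_props(3) assms by (auto simp: act_def has_degree_def)
next
  case False
  then show ?thesis
    using \<Phi>_props(5)[of xs vs] assms by (simp add: act_def algebra_simps)
qed

section \<open>The semidirect brackets on words from E and V\<close>

lemma brackets_multilinear: "multilinear brackets"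
proof -
  \<comment> \<open>A summand sees the letter \<open>w\<close> only through one of its parts: the
    V-part if the cut \<open>i\<close> comes at or before its position, the E-part
    otherwise.\<close>
  have slot: "\<Phi> (take i (map fst (A @ w # B))) (drop i (map snd (A @ w # B)))
      = (if i \<le> length A then \<Phi> (take i (map fst A)) (drop i (map snd A) @ snd w # map snd B)
         else \<Phi> (map fst A @ fst w # take (i - Suc (length A)) (map fst B)) (drop (i - Suc (length A)) (map snd B)))"
    for i A B and w :: "'e \<times> 'v"
  proof (cases "i \<le> length A")
    case False
    then have "length A < i"
      by simp
    from less_imp_Suc_add[OF this] obtain k where "i = Suc (length A + k)"
      by (rule exE)
    then show ?thesis by simp
  qed simp
  have len: "length (A @ w # B) = length A + Suc (length B)" for A B and w :: "'e \<times> 'v"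
    by simp
  have scale: "f (A @ (a *\<^sub>R b) # B) = a *\<^sub>R f (A @ b # B)" if "multilinear f"
    for f :: "'x::real_vector list \<Rightarrow> 'y::real_vector" and A a b B
    using that by (simp add: multilinear_def)
  show ?thesis
    unfolding multilinear_def
  proof (intro conjI allI)
    fix A B and b c :: "'e \<times> 'v"
    show "brackets (A @ (b + c) # B) = brackets (A @ b # B) + brackets (A @ c # B)"
      unfolding semidirect_brackets_def len slot
      by (simp add: multilinear_add l_props m_props \<Phi>_props multilinear_add[OF \<Phi>_props(1)]
          sum.distrib[symmetric] algebra_simps cong: if_cong) (intro impI sum.cong refl, simp)
  next
    fix A B and a :: real and b :: "'e \<times> 'v"
    show "brackets (A @ (a *\<^sub>R b) # B) = a *\<^sub>R brackets (A @ b # B)"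
      unfolding semidirect_brackets_def len slot
      by (simp add: scale l_props m_props \<Phi>_props scale[OF \<Phi>_props(1)]
          scaleR_sum_right scaleR_right_distrib cong: if_cong) (intro impI sum.cong refl, simp)
  qed
qed

lemma brackets_E:
  assumes "es \<noteq> []"
  shows "brackets (map (\<lambda>e. (e, 0)) es) = (l es, 0)"
proof -
  have "\<Phi> (take i es) (drop i (map (\<lambda>_. 0) es)) = 0" if "i \<in> {1..<length es}" for i
    using that by (intro multilinear_zero_mem[OF \<Phi>_props(2)]) (cases "drop i es", auto simp: drop_map)
  moreover have "m (map (\<lambda>_. 0) es) = 0"
    using assms by (intro multilinear_zero_mem[OF m_props(1)]) (cases es, auto)
  ultimately show ?thesis
    by (simp add: semidirect_brackets_def comp_def)
qed

text \<open>Any cut other than \<open>i = length es\<close> feeds \<open>\<Phi>\<close> a zero,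
  either the V-part of a letter of E or the E-part of a letter of V.\<close>

lemma brackets_EV:
  assumes "vs \<noteq> []"
  shows "brackets (map (\<lambda>e. (e, 0)) es @ map (\<lambda>v. (0, v)) vs) = (0, act es vs)"
proof -
  obtain v vs' where vs: "vs = v # vs'"
    using assms by (cases vs) auto
  let ?es = "es @ map (\<lambda>_. 0) vs" and ?vs = "map (\<lambda>_. 0) es @ vs"
  have l: "l ?es = 0"
    by (rule multilinear_zero_mem[OF l_props(1)]) (simp add: vs)
  have "\<Phi> (take i ?es) (drop i ?vs) = 0" if "i < length es" for i
    using that by (intro multilinear_zero_mem[OF \<Phi>_props(2)]) (cases "drop i es", auto simp: drop_map)
  moreover have "\<Phi> (take i ?es) (drop i ?vs) = 0" if "length es < i" for i
    using that by (intro multilinear_zero_mem[OF \<Phi>_props(1)]) (cases "i - length es", auto simp: vs)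
  ultimately have zero: "\<Phi> (take i ?es) (drop i ?vs) = 0" if "i \<noteq> length es" for i
    using that by (meson linorder_neqE_nat)
  have "\<Phi> (take i ?es) (drop i ?vs) = (if i = length es then \<Phi> es vs else 0)" for i
  proof (cases "i = length es")
    case False
    then show ?thesis
      using zero[OF False] by (simp only: if_False)
  qed simp
  then have "(\<Sum>i\<in>{1..<length es + length vs}. \<Phi> (take i ?es) (drop i ?vs))
      = (\<Sum>i\<in>{1..<length es + length vs}. if i = length es then \<Phi> es vs else 0)"
    by (simp only:)
  \<comment> \<open>For \<open>es = []\<close> the cut 0 lies outside the summation range, and
    \<open>m\<close>, which is \<open>act []\<close>, takes the place of this summand.\<close>
  also have "\<dots> = (if es = [] then 0 else \<Phi> es vs)"
    using assms by (auto simp: sum.delta Suc_le_eq)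
  finally have "(\<Sum>i\<in>{1..<length es + length vs}. \<Phi> (take i ?es) (drop i ?vs)) + m ?vs = act es vs"
    using multilinear_zero_mem[OF m_props(1), of ?vs] by (cases es) (auto simp: act_def)
  with l show ?thesis
    by (simp add: semidirect_brackets_def comp_def)
qed

text \<open>With the cut at or before \<open>v\<close>, the zero V-part of \<open>e\<close> is an
  input of \<open>\<Phi>\<close>; with a later cut, the zero E-part of \<open>v\<close> is. Likewise
  \<open>l\<close> meets the latter zero and \<open>m\<close> the former.\<close>

lemma brackets_unsorted: "brackets (A @ (0, v) # B @ (e, 0) # C) = 0"
proof -
  have "\<Phi> (take i (map fst A @ 0 # map fst B @ e # map fst C))
     (drop i (map snd A @ v # map snd B @ 0 # map snd C)) = 0" for i
  proof (cases "i \<le> length A")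
    case True
    then show ?thesis
      by (intro multilinear_zero_mem[OF \<Phi>_props(2)]) auto
  next
    case False
    then show ?thesis
      by (intro multilinear_zero_mem[OF \<Phi>_props(1)]) (cases "i - length A", auto)
  qed
  then show ?thesis
    by (simp add: semidirect_brackets_def multilinear_zero_mem l_props m_props zero_prod_def)
qed

lemma brackets_unsorted_word: "unsorted W \<Longrightarrow> brackets (vals W) = 0"
  unfolding unsorted_def by (auto simp: inE_def inV_def brackets_unsorted)

lemma fst_brackets: "fst (brackets ws) = l (map fst ws)"
  by (simp add: semidirect_brackets_def)

text \<open>Each cut is strictly before the end, so \<open>m\<close> and every \<open>\<Phi>\<close>
  take the V-part of the last letter as input.\<close>

lemma snd_brackets_last:
  assumes "ws \<noteq> []" "snd (last ws) = 0"
  shows "snd (brackets ws) = 0"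
proof -
  obtain us w where ws: "ws = us @ [w]" and w: "snd w = 0"
    using assms by (cases ws rule: rev_cases) auto
  have "\<Phi> (take i (map fst ws)) (drop i (map snd ws)) = 0" if "i \<in> {1..<length ws}" for i
    using that w by (intro multilinear_zero_mem[OF \<Phi>_props(2)]) (auto simp: ws)
  moreover have "m (map snd ws) = 0"
    using w by (intro multilinear_zero_mem[OF m_props(1)]) (auto simp: ws)
  ultimately show ?thesis
    by (simp add: semidirect_brackets_def)
qed

text \<open>The V-component of one summand of the squared coderivation; the sign is that of the
  degree 1 inner bracket passing \<open>T\<close>.\<close>

definition sq_term :: "(int \<times> 'e \<times> 'v) list \<Rightarrow> (int \<times> 'e \<times> 'v) list \<Rightarrow> (int \<times> 'e \<times> 'v) list \<Rightarrow> 'v" where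
  "sq_term T S r = ksgn (degsum T) *\<^sub>R snd (brackets (vals T @ brackets (vals S) # vals r))"

lemma snd_zcmp: "snd (zcmp brackets 1 brackets W) = zinb_sum sq_term W"
  unfolding zcmp_eq_zinb_sum snd_zinb_sum sq_term_def by simp

text \<open>The E-part of the brackets is \<open>l\<close> applied to E-parts, so projecting to E
  turns the square into that for \<open>l\<close>, which vanishes by the Jacobi identity of E. Only
  the V-component then remains to be studied.\<close>

lemma fst_zcmp:
  assumes "hom (\<lambda>d. HE d \<times> HV d) W" "W \<noteq> []"
  shows "fst (zcmp brackets 1 brackets W) = 0"
proof -
  let ?f = "\<lambda>g :: int \<times> 'e \<times> 'v. (fst g, fst (snd g))"
  have vals: "map fst (vals T) = vals (map ?f T)" for T :: "(int \<times> 'e \<times> 'v) list"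
    by (simp add: vals_def)
  have deg: "degsum (map ?f T) = degsum T" for T
    by (induction T) auto
  have "fst (zcmp brackets 1 brackets W)
     = zinb_sum (\<lambda>T S r. ksgn (1 * degsum (map ?f T)) *\<^sub>R
         l (vals (map ?f T) @ l (vals (map ?f S)) # vals (map ?f r))) W"
    unfolding zcmp_eq_zinb_sum fst_zinb_sum deg by (simp add: fst_brackets vals)
  also have "\<dots> = zinb_sum (\<lambda>T S r. ksgn (1 * degsum T) *\<^sub>R l (vals T @ l (vals S) # vals r)) (map ?f W)"
    by (rule zinb_sum_map[symmetric]) simp
  also have "\<dots> = cmp l l (map ?f W)"
    using assms l_props by (intro zinb_sum_eq_cmp[of HE]) (auto simp: hom_def has_degree_def)
  also have "\<dots> = 0"
    using assms by (intro l_cmp) (auto simp: hom_def)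
  finally show ?thesis .
qed

lemma sq_term_unsorted:
  "unsorted T \<Longrightarrow> sq_term T S r = 0" "unsorted S \<Longrightarrow> sq_term T S r = 0" "unsorted r \<Longrightarrow> sq_term T S r = 0"
proof -
  show "unsorted T \<Longrightarrow> sq_term T S r = 0"
    unfolding sq_term_def unsorted_def by (auto simp: inE_def inV_def brackets_unsorted)
  show "unsorted S \<Longrightarrow> sq_term T S r = 0"
    unfolding sq_term_def by (simp add: brackets_unsorted_word multilinear_zero[OF brackets_multilinear])
  assume "unsorted r"
  then obtain A v B y C where "r = A @ inV v # B @ inE y # C"
    unfolding unsorted_def by blast
  then show "sq_term T S r = 0"
    using brackets_unsorted[of "vals T @ brackets (vals S) # vals A" "snd v" "vals B" "snd y" "vals C"]
    by (simp add: sq_term_def inE_def inV_def)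
qed

text \<open>The final letter ends either the outer input or the inner one. In both cases the last
  outer input has zero V-part, and \<open>snd_brackets_last\<close> applies.\<close>

lemma zinb_sum_sq_term_last_E:
  assumes "last W = inE y"
  shows "zinb_sum sq_term W = 0"
proof -
  have "zinb_sum sq_term W = zinb_sum (\<lambda>T S r. 0) W"
  proof (rule zinb_sum_cong)
    fix T S r assume "S \<noteq> []" "last (S @ r) = last W"
    with assms have last: "last (S @ r) = inE y" by simp
    let ?ws = "vals T @ brackets (vals S) # vals r"
    have snd_last: "snd (last (vals W)) = 0" if "W \<noteq> []" "last W = inE y" for W :: "(int \<times> 'e \<times> 'v) list"
      using that by (simp add: vals_def last_map inE_def)
    have "snd (last ?ws) = 0"
    proof (cases "r = []")
      case True
      with last snd_last[of S] \<open>S \<noteq> []\<close> show ?thesis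
        by (simp add: snd_brackets_last)
    next
      case False
      with last snd_last[of r] show ?thesis by simp
    qed
    then show "sq_term T S r = 0"
      by (simp add: sq_term_def snd_brackets_last)
  qed
  then show ?thesis by simp
qed

section \<open>The square on words with all letters of E in front\<close>

lemma hom_unsh_sum: "mset L + mset R = mset gs \<Longrightarrow> hom H gs \<Longrightarrow> hom H L \<and> hom H R"
  by (metis Un_upper1 Un_upper2 hom_subset set_mset_mset set_mset_union)

lemma sq_term_EV:
  assumes "vals S = map (\<lambda>e. (e, 0)) es @ map (\<lambda>v. (0, v)) us" "us \<noteq> []"
    and "vals T = map (\<lambda>e. (e, 0)) es' @ map (\<lambda>v. (0, v)) us'" "vals r = map (\<lambda>v. (0, v)) ws"
  shows "sq_term T S r = ksgn (degsum T) *\<^sub>R act es' (us' @ act es us # ws)"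
  using brackets_EV[of "us' @ act es us # ws" es'] brackets_EV[of us es] assms
  by (simp add: sq_term_def)

text \<open>If the inner block closes among the letters of E, the inner bracket is \<open>l\<close>
  inside \<open>\<Phi>\<close>; if it closes among those of V, both brackets are instances of
  \<open>act\<close>. For nonempty \<open>xs\<close> the result is the action equation with all
  terms on one side.\<close>

lemma zinb_sum_sq_term_sorted:
  assumes xs: "hom HE xs" and vs: "hom HV vs" "vs \<noteq> []"
  shows "zinb_sum sq_term (map inE xs @ map inV vs)
    = (unsh_sum (\<lambda>S R. \<Phi> (l (vals S) # vals R) (vals vs)) xs - \<Phi> (l [] # vals xs) (vals vs))
      + unsh_sum (\<lambda>T R. ksgn (degsum T) *\<^sub>R cmp (act (vals T)) (act (vals R)) vs) xs"
proof -
  have "zinb_sum (\<lambda>T S r. sq_term T S (r @ map inV vs)) (map inE xs)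
     = zinb_sum (\<lambda>T S r. sq_term (map inE T) (map inE S) (map inE r @ map inV vs)) xs"
    by (rule zinb_sum_map) simp
  also have "\<dots> = zinb_sum (\<lambda>T S r. ksgn (1 * degsum T) *\<^sub>R \<Phi> (vals T @ l (vals S) # vals r) (vals vs)) xs"
  proof (rule zinb_sum_cong)
    fix T S r :: "(int \<times> 'e) list" assume "S \<noteq> []"
    then show "sq_term (map inE T) (map inE S) (map inE r @ map inV vs)
        = ksgn (1 * degsum T) *\<^sub>R \<Phi> (vals T @ l (vals S) # vals r) (vals vs)"
      using brackets_EV[of "vals vs" "vals T @ l (vals S) # vals r"] brackets_E[of "vals S"] vs
      by (simp add: sq_term_def act_def)
  qed
  also have "\<dots> = unsh_sum (\<lambda>S R. \<Phi> (l (vals S) # vals R) (vals vs)) xs - \<Phi> (l [] # vals xs) (vals vs)"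
    using l_props(3) xs
    by (intro zinb_sum_eq_unsh_sum_insertion[of HE "\<lambda>es. \<Phi> es (vals vs)"]) (auto simp: \<Phi>_props has_degree_def)
  finally have 1: "zinb_sum (\<lambda>T S r. sq_term T S (r @ map inV vs)) (map inE xs) = \<dots>" .
  \<comment> \<open>The inner map has degree \<open>degsum R + 1\<close>: the sign of
    \<open>R\<close> passing \<open>T'\<close> and the contribution of \<open>T'\<close> to the sign
    in \<open>sq_term\<close> unite to the one expected for \<open>cmp\<close>.\<close>
  have inner: "zinb_sum (\<lambda>T' S r. ksgn (degsum R * degsum T') *\<^sub>R
         sq_term (map inE T @ map inV T') (map inE R @ map inV S) (map inV r)) vs
      = ksgn (degsum T) *\<^sub>R cmp (act (vals T)) (act (vals R)) vs" if R: "hom HE R" for T R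
  proof -
    have "zinb_sum (\<lambda>T' S r. ksgn (degsum R * degsum T') *\<^sub>R
         sq_term (map inE T @ map inV T') (map inE R @ map inV S) (map inV r)) vs
       = zinb_sum (\<lambda>T' S r. ksgn (degsum T) *\<^sub>R ksgn ((degsum R + 1) * degsum T') *\<^sub>R
         act (vals T) (vals T' @ act (vals R) (vals S) # vals r)) vs"
    proof (rule zinb_sum_cong)
      fix T' S r :: "(int \<times> 'v) list" assume "S \<noteq> []"
      then show "ksgn (degsum R * degsum T') *\<^sub>R
           sq_term (map inE T @ map inV T') (map inE R @ map inV S) (map inV r)
         = ksgn (degsum T) *\<^sub>R ksgn ((degsum R + 1) * degsum T') *\<^sub>R
           act (vals T) (vals T' @ act (vals R) (vals S) # vals r)"
        by (subst sq_term_EV[where es = "vals R" and us = "vals S" and es' = "vals T" and us' = "vals T'"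
              and ws = "vals r"]) (auto simp: ksgn_def distrib_right)
    qed
    then show ?thesis
      unfolding zinb_sum_scaleR using R vs
      by (simp add: zinb_sum_eq_cmp[OF act_graded_symmetric vs(1)] act_degree)
  qed
  have "unsh_sum (\<lambda>T R. zinb_sum (\<lambda>T' S r. ksgn (degsum R * degsum T') *\<^sub>R sq_term (T @ T') (R @ S) r) (map inV vs))
       (map inE xs)
     = unsh_sum (\<lambda>T R. zinb_sum (\<lambda>T' S r. ksgn (degsum R * degsum T') *\<^sub>R
         sq_term (map inE T @ map inV T') (map inE R @ map inV S) (map inV r)) vs) xs"
    by (simp add: unsh_sum_map zinb_sum_map)
  also have "\<dots> = unsh_sum (\<lambda>T R. ksgn (degsum T) *\<^sub>R cmp (act (vals T)) (act (vals R)) vs) xs"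
    using xs by (intro unsh_sum_cong inner) (auto dest: hom_unsh_sum)
  finally show ?thesis
    unfolding zinb_sum_append 1 by simp
qed

text \<open>With \<open>\<Phi> []\<close> read as \<open>m\<close>, the differential is the bracket
  with one block empty. The two halves of a graded commutator give the same sum once blocks are
  exchanged, which cancels the factor 1/2 of the action equation.\<close>

lemma action_identity:
  assumes xs: "hom HE xs" "xs \<noteq> []" and vs: "hom HV vs" "vs \<noteq> []"
  shows "(unsh_sum (\<lambda>S R. \<Phi> (l (vals S) # vals R) (vals vs)) xs - \<Phi> (l [] # vals xs) (vals vs))
      + unsh_sum (\<lambda>T R. ksgn (degsum T) *\<^sub>R cmp (act (vals T)) (act (vals R)) vs) xs = 0"
proof -
  let ?B = "\<lambda>T R. cbr (degsum T) (act (vals T)) (degsum R) (act (vals R)) vs"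
  let ?U = "unsh_sum (\<lambda>T R. ksgn (degsum T) *\<^sub>R cmp (act (vals T)) (act (vals R)) vs) xs"
  let ?D = "cdiff m (degsum xs) (\<Phi> (vals xs)) vs"
  have "unsh_sum ?B xs = unsh_sum (\<lambda>T R. ksgn (degsum T + 1) *\<^sub>R cmp (act (vals T)) (act (vals R)) vs) xs
      - unsh_sum (\<lambda>T R. (ksgn (degsum T + 1) * ksgn ((degsum T + 1) * (degsum R + 1))) *\<^sub>R
          cmp (act (vals R)) (act (vals T)) vs) xs"
    unfolding cbr_def unsh_sum_diff[symmetric] by (simp add: scaleR_right_diff_distrib)
  also have "unsh_sum (\<lambda>T R. ksgn (degsum T + 1) *\<^sub>R cmp (act (vals T)) (act (vals R)) vs) xs = - ?U"
    unfolding ksgn_add using unsh_sum_scaleR[of "-1" "\<lambda>T R. ksgn (degsum T) *\<^sub>R cmp (act (vals T)) (act (vals R)) vs" xs]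
    by (simp add: ksgn_def)
  also have "unsh_sum (\<lambda>T R. (ksgn (degsum T + 1) * ksgn ((degsum T + 1) * (degsum R + 1))) *\<^sub>R
          cmp (act (vals R)) (act (vals T)) vs) xs = ?U"
    by (subst unsh_sum_swap) (rule unsh_sum_cong, auto simp: ksgn_def distrib_left distrib_right)
  finally have U: "unsh_sum ?B xs = - 2 *\<^sub>R ?U"
    by (simp add: scaleR_2)
  \<comment> \<open>The two unshuffles with an empty block each reproduce the differential; the sum
    of brackets in the action equation leaves both out.\<close>
  have D1: "?B [] xs = ?D"
    using xs by (simp add: cbr_def cdiff_def act_def ksgn_def)
  have D2: "?B xs [] = ?D"
    using xs by (simp add: cbr_def cdiff_def act_def ksgn_def)
  have "(\<Sum>S\<in>nsubs (length xs) - {{0..<length xs}}. ksign (map fst xs) S *\<^sub>R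
       cbr (degsum (nths xs S)) (\<Phi> (vals (nths xs S)))
           (degsum (nths xs (- S))) (\<Phi> (vals (nths xs (- S)))) vs)
     = (\<Sum>S\<in>nsubs (length xs) - {{0..<length xs}}. ksign (map fst xs) S *\<^sub>R
          ?B (nths xs S) (nths xs (- S)))"
    by (rule sum_proper_nsubs_cong) (simp add: act_def)
  also have "\<dots> = unsh_sum ?B xs - ?B [] xs - ?B xs []"
    by (rule sum_proper_nsubs_ksign[OF xs(2)])
  finally have proper: "(\<Sum>S\<in>nsubs (length xs) - {{0..<length xs}}. ksign (map fst xs) S *\<^sub>R
       cbr (degsum (nths xs S)) (\<Phi> (vals (nths xs S)))
           (degsum (nths xs (- S))) (\<Phi> (vals (nths xs (- S)))) vs) = - 2 *\<^sub>R (?U + ?D)"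
    unfolding U D1 D2 by (simp add: scaleR_2)
  have "unsh_sum (\<lambda>S R. \<Phi> (l (vals S) # vals R) (vals vs)) xs - \<Phi> (l [] # vals xs) (vals vs)
      = (\<Sum>S\<in>nsubs (length xs). ksign (map fst xs) S *\<^sub>R
        \<Phi> (l (vals (nths xs S)) # vals (nths xs (- S))) (vals vs))"
    using sum_nsubs_ksign[of xs "\<lambda>S R. \<Phi> (l (vals S) # vals R) (vals vs)"] by simp
  also have "\<dots> = ?D + (1/2) *\<^sub>R (\<Sum>S\<in>nsubs (length xs) - {{0..<length xs}}. ksign (map fst xs) S *\<^sub>R
         cbr (degsum (nths xs S)) (\<Phi> (vals (nths xs S)))
             (degsum (nths xs (- S))) (\<Phi> (vals (nths xs (- S)))) vs)"
    using action xs vs unfolding lie_infty_action_def by blast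
  also have "\<dots> = - ?U"
    unfolding proper by simp
  finally show ?thesis
    by simp
qed

lemma zinb_sum_sq_term_sorted_eq_0:
  assumes xs: "hom HE xs" and vs: "hom HV vs" and "map inE xs @ map inV vs \<noteq> []"
  shows "zinb_sum sq_term (map inE xs @ map inV vs) = 0"
proof -
  consider "vs = []" "xs \<noteq> []" | "xs = []" "vs \<noteq> []" | "xs \<noteq> []" "vs \<noteq> []"
    using assms by auto
  then show ?thesis
  proof cases
    case 1
    then show ?thesis
      using zinb_sum_sq_term_last_E[of "map inE xs" "last xs"] by (simp add: last_map)
  next
    case 2
    then show ?thesis
      using zinb_sum_sq_term_sorted[of "[]" vs] vs m_cmp[of vs] by (simp add: act_def)
  next
    case 3
    then show ?thesis
      using zinb_sum_sq_term_sorted[OF xs vs] action_identity[OF xs _ vs] by simp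
  qed
qed

section \<open>The square on words with a letter of V before a letter of E\<close>

text \<open>The case \<open>xs = []\<close> is the bracket with \<open>ad_v\<close>.\<close>

definition commutator ::
  "(int \<times> 'e) list \<Rightarrow> (int \<times> 'v) list \<Rightarrow> (int \<times> 'e) list \<Rightarrow> (int \<times> 'v) list \<Rightarrow> 'v" where
  "commutator xs vs ys ws =
     cbr (degsum xs + degsum vs) (\<lambda>us. act (vals xs) (vals vs @ us)) (degsum ys) (act (vals ys)) ws"

lemma coherent_iff_commutator:
  "coherent HE HV m \<Phi> \<longleftrightarrow> (\<forall>xs vs ys ws. hom HE xs \<and> hom HV vs \<and> hom HE ys \<and> hom HV ws
     \<and> vs \<noteq> [] \<and> ys \<noteq> [] \<and> ws \<noteq> [] \<longrightarrow> commutator xs vs ys ws = 0)"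
proof -
  have 1: "commutator [] vs ys ws = cbr (degsum vs) (\<lambda>us. m (vals vs @ us)) (degsum ys) (\<Phi> (vals ys)) ws"
    if "ys \<noteq> []" for vs ys ws
    using that by (simp add: commutator_def act_def)
  have 2: "commutator xs vs ys ws
      = cbr (degsum xs + degsum vs) (\<lambda>us. \<Phi> (vals xs) (vals vs @ us)) (degsum ys) (\<Phi> (vals ys)) ws"
    if "xs \<noteq> []" "ys \<noteq> []" for xs vs ys ws
    using that by (simp add: commutator_def act_def)
  have "(\<forall>xs vs ys ws. hom HE xs \<and> hom HV vs \<and> hom HE ys \<and> hom HV ws
     \<and> vs \<noteq> [] \<and> ys \<noteq> [] \<and> ws \<noteq> [] \<longrightarrow> commutator xs vs ys ws = 0) \<longleftrightarrow>
     (\<forall>ys vs ws. ys \<noteq> [] \<and> vs \<noteq> [] \<and> ws \<noteq> [] \<and> hom HE ys \<and> hom HV vs \<and> hom HV ws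
        \<longrightarrow> commutator [] vs ys ws = 0) \<and>
     (\<forall>ys xs vs ws. ys \<noteq> [] \<and> xs \<noteq> [] \<and> vs \<noteq> [] \<and> ws \<noteq> [] \<and>
        hom HE ys \<and> hom HE xs \<and> hom HV vs \<and> hom HV ws \<longrightarrow> commutator xs vs ys ws = 0)"
    (is "?A \<longleftrightarrow> ?B \<and> ?C")
  proof
    show "?A \<Longrightarrow> ?B \<and> ?C" by simp
    show "?B \<and> ?C \<Longrightarrow> ?A" by metis
  qed
  then show ?thesis
    unfolding coherent_def by (simp add: 1 2 cong: conj_cong)
qed

text \<open>Apart from zero letters, one of the two brackets receives a V-input before an E-input.
  The V-input is \<open>v\<close> or, if \<open>v\<close> is in \<open>S\<close>, possibly the inner
  value; the E-input is \<open>y\<close> or the value of an inner bracket ending in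
  \<open>y\<close>.\<close>

lemma sq_term_misplaced_E:
  assumes mset: "mset T + mset S + mset r = mset U" and v: "inV v \<in> set U"
    and S: "S \<noteq> []" and last: "last (S @ r) = inE y" and vs: "vs \<noteq> []"
  shows "sq_term T S (r @ map inV vs) = 0"
proof -
  from mset have "set T \<union> set S \<union> set r = set U"
    by (metis set_mset_mset set_mset_union)
  with v consider "inV v \<in> set T" | "inV v \<in> set S" | "inV v \<in> set r"
    by blast
  then show ?thesis
  proof cases
    case 1
    have T: "brackets (vals T @ A @ (e, 0) # B) = 0" for A e B
    proof -
      obtain T1 T2 where "T = T1 @ inV v # T2"
        using 1 by (meson split_list)
      then show ?thesis
        using brackets_unsorted[of "vals T1" "snd v" "vals T2 @ A"] by (simp add: inV_def)
    qed
    show ?thesis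
    proof (cases "r = []")
      case True
      with last S have "snd (brackets (vals S)) = 0"
        by (intro snd_brackets_last) (auto simp: vals_def last_map inE_def)
      then obtain e where "brackets (vals S) = (e, 0)"
        by (metis prod.collapse)
      with T[of "[]" e] show ?thesis
        by (simp add: sq_term_def)
    next
      case False
      with last obtain r' where "r = r' @ [inE y]"
        by (metis append_butlast_last_id last_appendR)
      with T[of "brackets (vals S) # vals r'"] show ?thesis
        by (simp add: sq_term_def inE_def)
    qed
  next
    case 2
    show ?thesis
    proof (cases "r = []")
      case True
      with last S obtain S' where "S = S' @ [inE y]"
        by (metis append.right_neutral append_butlast_last_id)
      \<comment> \<open>Only a zero letter belongs to both E and V, and multilinearity disposes of
        it.\<close>
      with 2 have "inV v \<in> set S' \<or> inV v = (inE y :: int \<times> 'e \<times> 'v)"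
        by auto
      then show ?thesis
      proof
        assume "inV v \<in> set S'"
        then have "unsorted S"
          using unsorted_if_mem[of v S' y "[inE y]"] \<open>S = _\<close> by simp
        then show ?thesis
          by (rule sq_term_unsorted)
      next
        assume "inV v = (inE y :: int \<times> 'e \<times> 'v)"
        then have "snd (inE y :: int \<times> 'e \<times> 'v) = 0"
          by (simp add: inV_def inE_def zero_prod_def)
        then have "brackets (vals S) = 0"
          by (intro multilinear_zero_mem[OF brackets_multilinear]) (simp add: \<open>S = _\<close>)
        then show ?thesis
          by (simp add: sq_term_def multilinear_zero[OF brackets_multilinear])
      qed
    next
      case False
      with last obtain r' where r: "r = r' @ [inE y]"
        by (metis append_butlast_last_id last_appendR)
      have "fst (brackets (vals S)) = 0"
        unfolding fst_brackets using 2
        by (intro multilinear_zero_mem[OF l_props(1)]) (force simp: vals_def inV_def)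
      then obtain w where "brackets (vals S) = (0, w)"
        by (metis prod.collapse)
      then show ?thesis
        using brackets_unsorted[of "vals T" w "vals r'" "snd y"] by (simp add: sq_term_def r inE_def)
    qed
  next
    case 3
    with last obtain r' where r: "r = r' @ [inE y]"
      by (metis append_butlast_last_id empty_iff last_appendR list.set(1))
    with 3 consider "inV v \<in> set r'" | "inV v = (inE y :: int \<times> 'e \<times> 'v)"
      by auto
    then show ?thesis
    proof cases
      case 1
      then have "unsorted r"
        using unsorted_if_mem[of v r' y "[inE y]"] r by simp
      then show ?thesis
        by (intro sq_term_unsorted unsorted_append1)
    next
      case 2
      then have "snd (inE y :: int \<times> 'e \<times> 'v) = 0"
        by (simp add: inV_def inE_def zero_prod_def)
      then show ?thesis
        using multilinear_zero_mem[OF brackets_multilinear, of "vals T @ brackets (vals S) # vals (r @ map inV vs)"]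
        by (simp add: sq_term_def r)
    qed
  qed
qed

text \<open>Distributing the trailing letters \<open>ws\<close> over the two brackets gives the
  composite with outer map \<open>\<Phi>_{x;v}\<close> and inner map \<open>\<Phi>_{x' y}\<close>;
  \<open>T'\<close> is passed by an inner map of degree
  \<open>degsum xs' + degsum ys + 1\<close>.\<close>

lemma zinb_sum_sq_term_outer_V:
  assumes xs: "hom HE xs" and vs: "hom HV vs" "vs \<noteq> []" and ys: "hom HE ys" "ys \<noteq> []"
    and xs': "hom HE xs'" and ws: "hom HV ws"
  shows "zinb_sum (\<lambda>T' S r. ksgn (degsum (map inE xs' @ map inE ys) * degsum T') *\<^sub>R
       sq_term ((map inE xs @ map inV vs) @ T') ((map inE xs' @ map inE ys) @ S) r) (map inV ws)
     = ksgn (degsum xs + degsum vs) *\<^sub>R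
       cmp (\<lambda>us. act (vals xs) (vals vs @ us)) (act (vals (xs' @ ys))) ws" (is "?lhs = _")
proof -
  have "?lhs = zinb_sum (\<lambda>T' S r. ksgn (degsum xs + degsum vs) *\<^sub>R ksgn ((degsum (xs' @ ys) + 1) * degsum T') *\<^sub>R
      act (vals xs) (vals vs @ vals T' @ act (vals (xs' @ ys)) (vals S) # vals r)) ws"
    unfolding zinb_sum_map[of inV, OF fst_in(2)]
  proof (rule zinb_sum_cong)
    fix T' S r :: "(int \<times> 'v) list" assume S: "S \<noteq> []"
    have sign: "ksgn ((degsum xs' + degsum ys) * degsum T') * ksgn (degsum xs + degsum vs + degsum T')
      = ksgn (degsum xs + degsum vs) * ksgn ((degsum xs' + degsum ys + 1) * degsum T')"
      by (auto simp: ksgn_def)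
    have "sq_term ((map inE xs @ map inV vs) @ map inV T') ((map inE xs' @ map inE ys) @ map inV S) (map inV r)
      = ksgn (degsum xs + degsum vs + degsum T') *\<^sub>R
        act (vals xs) (vals vs @ vals T' @ act (vals (xs' @ ys)) (vals S) # vals r)"
      by (subst sq_term_EV[where es = "vals (xs' @ ys)" and us = "vals S" and es' = "vals xs"
            and us' = "vals vs @ vals T'" and ws = "vals r"]) (use S in \<open>simp_all add: add.assoc\<close>)
    then show "ksgn (degsum (map inE xs' @ map inE ys) * degsum (map inV T')) *\<^sub>R
        sq_term ((map inE xs @ map inV vs) @ map inV T') ((map inE xs' @ map inE ys) @ map inV S) (map inV r)
      = ksgn (degsum xs + degsum vs) *\<^sub>R ksgn ((degsum (xs' @ ys) + 1) * degsum T') *\<^sub>R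
        act (vals xs) (vals vs @ vals T' @ act (vals (xs' @ ys)) (vals S) # vals r)"
      by (simp only: degsum_map_in degsum_simps scaleR_scaleR sign)
  qed
  also have "\<dots> = ksgn (degsum xs + degsum vs) *\<^sub>R
       cmp (\<lambda>us. act (vals xs) (vals vs @ us)) (act (vals (xs' @ ys))) ws"
  proof -
    have "act (vals (xs' @ ys)) (vals S) \<in> HV (degsum S + (degsum (xs' @ ys) + 1))"
      if "S \<noteq> []" "hom HV S" for S
      using act_degree[of S "xs' @ ys"] that xs' ys by (simp del: vals_simps degsum_simps)
    then show ?thesis
      unfolding zinb_sum_scaleR
      by (subst zinb_sum_eq_cmp[OF act_graded_symmetric_prefix[OF vs(1)] ws, of "act (vals (xs' @ ys))"]) auto
  qed
  finally show ?thesis .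
qed

text \<open>The mirror case: \<open>vs\<close> enters the inner bracket, which becomes
  \<open>\<Phi>_{x';v}\<close>, of degree \<open>degsum xs' + degsum vs + 1\<close>.\<close>

lemma zinb_sum_sq_term_outer_E:
  assumes xs: "hom HE xs" and vs: "hom HV vs" "vs \<noteq> []" and ys: "hom HE ys" "ys \<noteq> []"
    and xs': "hom HE xs'" and ws: "hom HV ws"
  shows "zinb_sum (\<lambda>T' S r. ksgn (degsum (map inE xs' @ map inV vs) * degsum T') *\<^sub>R
       sq_term ((map inE xs @ map inE ys) @ T') ((map inE xs' @ map inV vs) @ S) r) (map inV ws)
     = ksgn (degsum xs + degsum ys) *\<^sub>R
       cmp (act (vals (xs @ ys))) (\<lambda>us. act (vals xs') (vals vs @ us)) ws" (is "?lhs = _")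
proof -
  have "?lhs = zinb_sum (\<lambda>T' S r. ksgn (degsum xs + degsum ys) *\<^sub>R
      ksgn ((degsum xs' + degsum vs + 1) * degsum T') *\<^sub>R
      act (vals (xs @ ys)) (vals T' @ act (vals xs') (vals vs @ vals S) # vals r)) ws"
    unfolding zinb_sum_map[of inV, OF fst_in(2)]
  proof (rule zinb_sum_cong)
    fix T' S r :: "(int \<times> 'v) list" assume S: "S \<noteq> []"
    have sign: "ksgn ((degsum xs' + degsum vs) * degsum T') * ksgn (degsum xs + degsum ys + degsum T')
      = ksgn (degsum xs + degsum ys) * ksgn ((degsum xs' + degsum vs + 1) * degsum T')"
      by (auto simp: ksgn_def)
    have "sq_term ((map inE xs @ map inE ys) @ map inV T') ((map inE xs' @ map inV vs) @ map inV S) (map inV r)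
      = ksgn (degsum xs + degsum ys + degsum T') *\<^sub>R
        act (vals (xs @ ys)) (vals T' @ act (vals xs') (vals vs @ vals S) # vals r)"
      by (subst sq_term_EV[where es = "vals xs'" and us = "vals vs @ vals S" and es' = "vals (xs @ ys)"
            and us' = "vals T'" and ws = "vals r"]) (use S in \<open>simp_all add: add.assoc\<close>)
    then show "ksgn (degsum (map inE xs' @ map inV vs) * degsum (map inV T')) *\<^sub>R
        sq_term ((map inE xs @ map inE ys) @ map inV T') ((map inE xs' @ map inV vs) @ map inV S) (map inV r)
      = ksgn (degsum xs + degsum ys) *\<^sub>R ksgn ((degsum xs' + degsum vs + 1) * degsum T') *\<^sub>R
        act (vals (xs @ ys)) (vals T' @ act (vals xs') (vals vs @ vals S) # vals r)"
      by (simp only: degsum_map_in degsum_simps scaleR_scaleR sign)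
  qed
  also have "\<dots> = ksgn (degsum xs + degsum ys) *\<^sub>R
       cmp (act (vals (xs @ ys))) (\<lambda>us. act (vals xs') (vals vs @ us)) ws"
  proof -
    have "act (vals xs') (vals vs @ vals S) \<in> HV (degsum S + (degsum xs' + degsum vs + 1))"
      if "hom HV S" for S
      using act_degree[of "vs @ S" xs'] that xs' vs by (simp add: algebra_simps)
    then show ?thesis
      unfolding zinb_sum_scaleR
      by (subst zinb_sum_eq_cmp[OF act_graded_symmetric ws, of "\<lambda>us. act (vals xs') (vals vs @ us)"]) auto
  qed
  finally show ?thesis .
qed

text \<open>For each splitting of \<open>xs\<close>, one part joins \<open>vs\<close> and the other
  joins \<open>ys\<close>. The two composites, with either bracket as the inner one, are the halves
  of one graded commutator.\<close>

lemma zinb_sum_sq_term_mixed: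
  assumes xs: "hom HE xs" and ws: "hom HV ws" "ws \<noteq> []"
    and M: "sorting s M vs0 ys0" and vs: "hom HV (v # vs0)" and ys: "hom HE (ys0 @ [y])"
  defines "vs \<equiv> v # vs0" and "ys \<equiv> ys0 @ [y]"
  shows "zinb_sum sq_term (map inE xs @ (inV v # M @ [inE y]) @ map inV ws)
    = s *\<^sub>R unsh_sum (\<lambda>L R. (- ksgn (degsum R * degsum vs)) *\<^sub>R commutator L vs (R @ ys) ws) xs"
proof -
  let ?M = "inV v # M @ [inE y]"
  \<comment> \<open>\<open>K T R\<close> collects the terms whose inner block closes in
    \<open>ws\<close>, when the letters before \<open>ws\<close> contribute \<open>T\<close> to the
    outer prefix and \<open>R\<close> to the inner inputs.\<close>
  define K where "K T R = zinb_sum (\<lambda>T' S r. ksgn (degsum R * degsum T') *\<^sub>R sq_term (T @ T') (R @ S) r) (map inV ws)"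
    for T R
  let ?C1 = "\<lambda>L R. cmp (\<lambda>us. act (vals L) (vals vs @ us)) (act (vals (R @ ys))) ws"
  let ?C2 = "\<lambda>L R. cmp (act (vals (R @ ys))) (\<lambda>us. act (vals L) (vals vs @ us)) ws"
  have hv: "hom HV vs" "vs \<noteq> []" and hy: "hom HE ys" "ys \<noteq> []"
    using vs ys by (simp_all add: vs_def ys_def)
  have K0: "K T R = 0" if "unsorted T \<or> unsorted R" for T R
  proof -
    have "sq_term (T @ T') (R @ S) r = 0" for T' S r
      using that sq_term_unsorted(1,2) unsorted_append1 by metis
    then show ?thesis
      by (simp add: K_def)
  qed
  have unsorted_prefix: "unsorted (A @ B)" if "unsorted B" for A B :: "(int \<times> 'e \<times> 'v) list"
    using that unfolding unsorted_def by (metis append.assoc)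
  \<comment> \<open>Terms whose inner block closes before \<open>ws\<close> contain a misplaced
    letter of E and vanish.\<close>
  have "zinb_sum (\<lambda>T S r. sq_term T S (r @ map inV ws)) (map inE xs @ ?M) = zinb_sum (\<lambda>T S r. 0) (map inE xs @ ?M)"
    by (rule zinb_sum_cong) (rule sq_term_misplaced_E[where U = "map inE xs @ ?M" and v = v and y = y], use ws in auto)
  then have "zinb_sum sq_term ((map inE xs @ ?M) @ map inV ws) = unsh_sum K (map inE xs @ ?M)"
    unfolding zinb_sum_append[of sq_term] K_def by simp
  also have "\<dots> = unsh_sum (\<lambda>L R. unsh_sum (\<lambda>L' R'. ksgn (degsum R * degsum L') *\<^sub>R
      K (map inE L @ L') (map inE R @ R')) ?M) xs"
    unfolding unsh_sum_append by (simp add: unsh_sum_map)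
  also have "\<dots> = unsh_sum (\<lambda>L R. s *\<^sub>R (ksgn (degsum R * degsum vs) *\<^sub>R ksgn (degsum L + degsum vs) *\<^sub>R ?C1 L R
       + ksgn (degsum vs * degsum ys) *\<^sub>R ksgn (degsum R * degsum ys) *\<^sub>R ksgn (degsum L + degsum ys) *\<^sub>R ?C2 R L)) xs"
  proof (rule unsh_sum_cong)
    fix L R assume "mset L + mset R = mset xs"
    with xs have h: "hom HE L" "hom HE R"
      using hom_unsh_sum by blast+
    have "unsh_sum (\<lambda>L' R'. ksgn (degsum R * degsum L') *\<^sub>R K (map inE L @ L') (map inE R @ R')) ?M
       = s *\<^sub>R (ksgn (degsum R * degsum vs) *\<^sub>R K (map inE L @ map inV vs) (map inE R @ map inE ys)
       + ksgn (degsum vs * degsum ys) *\<^sub>R ksgn (degsum R * degsum ys) *\<^sub>R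
           K (map inE L @ map inE ys) (map inE R @ map inV vs))"
      unfolding vs_def ys_def by (subst unsh_sum_mixed[OF M]) (simp_all add: K0 unsorted_prefix)
    then show "unsh_sum (\<lambda>L' R'. ksgn (degsum R * degsum L') *\<^sub>R K (map inE L @ L') (map inE R @ R')) ?M
       = s *\<^sub>R (ksgn (degsum R * degsum vs) *\<^sub>R ksgn (degsum L + degsum vs) *\<^sub>R ?C1 L R
       + ksgn (degsum vs * degsum ys) *\<^sub>R ksgn (degsum R * degsum ys) *\<^sub>R ksgn (degsum L + degsum ys) *\<^sub>R ?C2 R L)"
      unfolding K_def
      by (simp only: zinb_sum_sq_term_outer_V[OF h(1) hv hy h(2) ws(1)] zinb_sum_sq_term_outer_E[OF h(1) hv hy h(2) ws(1)])
  qed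
  also have "\<dots> = s *\<^sub>R (unsh_sum (\<lambda>L R. (ksgn (degsum R * degsum vs) * ksgn (degsum L + degsum vs)) *\<^sub>R ?C1 L R) xs
     + unsh_sum (\<lambda>L R. (ksgn (degsum vs * degsum ys) * ksgn (degsum R * degsum ys) * ksgn (degsum L + degsum ys)) *\<^sub>R ?C2 R L) xs)"
    by (simp add: unsh_sum_scaleR unsh_sum_add mult.assoc)
  \<comment> \<open>After exchanging the blocks, \<open>L\<close> is the part of \<open>xs\<close>
    that joins \<open>vs\<close> in both composites.\<close>
  also have "unsh_sum (\<lambda>L R. (ksgn (degsum vs * degsum ys) * ksgn (degsum R * degsum ys) * ksgn (degsum L + degsum ys)) *\<^sub>R ?C2 R L) xs
     = unsh_sum (\<lambda>L R. (ksgn (degsum L * degsum R) * ksgn (degsum vs * degsum ys) * ksgn (degsum L * degsum ys)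
         * ksgn (degsum R + degsum ys)) *\<^sub>R ?C2 L R) xs"
    by (subst unsh_sum_swap) (simp add: mult.assoc)
  also have "unsh_sum (\<lambda>L R. (ksgn (degsum R * degsum vs) * ksgn (degsum L + degsum vs)) *\<^sub>R ?C1 L R) xs + \<dots>
     = unsh_sum (\<lambda>L R. (- ksgn (degsum R * degsum vs)) *\<^sub>R commutator L vs (R @ ys) ws) xs"
    unfolding unsh_sum_add[symmetric]
  proof (rule unsh_sum_cong)
    fix L R :: "(int \<times> 'e) list"
    have 1: "ksgn (degsum R * degsum vs) * ksgn (degsum L + degsum vs)
        = - ksgn (degsum R * degsum vs) * ksgn (degsum L + degsum vs + 1)"
      by (simp add: ksgn_def)
    \<comment> \<open>Up to the factor shared with the first composite, this is the sign with which
      the reversed composite enters \<open>cbr\<close>.\<close>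
    have 2: "ksgn (degsum L * degsum R) * ksgn (degsum vs * degsum ys) * ksgn (degsum L * degsum ys)
         * ksgn (degsum R + degsum ys)
        = ksgn (degsum R * degsum vs) * ksgn (degsum L + degsum vs + 1)
          * ksgn ((degsum L + degsum vs + 1) * (degsum (R @ ys) + 1))"
      by (auto simp: ksgn_def)
    show "(ksgn (degsum R * degsum vs) * ksgn (degsum L + degsum vs)) *\<^sub>R ?C1 L R
        + (ksgn (degsum L * degsum R) * ksgn (degsum vs * degsum ys) * ksgn (degsum L * degsum ys)
           * ksgn (degsum R + degsum ys)) *\<^sub>R ?C2 L R
      = (- ksgn (degsum R * degsum vs)) *\<^sub>R commutator L vs (R @ ys) ws"
      unfolding 1 2 commutator_def cbr_def
      by (simp add: scaleR_right_diff_distrib mult.assoc)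
  qed
  finally show ?thesis
    by simp
qed

section \<open>Vanishing of the square versus coherence\<close>

lemma loday_iff_coherent:
  "loday_sq_zero (\<lambda>d. HE d \<times> HV d) brackets \<longleftrightarrow> coherent HE HV m \<Phi>"
proof
  assume coh: "coherent HE HV m \<Phi>"
  have pure: "zinb_sum sq_term W = 0" if "W \<noteq> []" "pure HE HV W" for W
    using that(2)
  proof (cases rule: pure_cases)
    case (sorted xs vs)
    with that(1) show ?thesis
      using zinb_sum_sq_term_sorted_eq_0 by blast
  next
    case (mixed xs v M y ws)
    show ?thesis
    proof (cases "ws = []")
      case True
      then show ?thesis
        using zinb_sum_sq_term_last_E[of W y] mixed(1) by simp
    next
      case False
      from mixed(4) obtain s vs ys where M: "sorting s M vs ys" "hom HV vs" "hom HE ys"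
        by (rule pure_sorting)
      have "unsh_sum (\<lambda>L R. (- ksgn (degsum R * degsum (v # vs))) *\<^sub>R commutator L (v # vs) (R @ ys @ [y]) ws) xs
         = unsh_sum (\<lambda>L R. 0) xs"
      proof (rule unsh_sum_cong)
        fix L R assume "mset L + mset R = mset xs"
        then have "hom HE L" "hom HE R"
          using mixed(2) hom_unsh_sum by blast+
        then have "commutator L (v # vs) (R @ ys @ [y]) ws = 0"
          using coh[unfolded coherent_iff_commutator] M mixed False by simp
        then show "(- ksgn (degsum R * degsum (v # vs))) *\<^sub>R commutator L (v # vs) (R @ ys @ [y]) ws = 0"
          by simp
      qed
      then show ?thesis
        using zinb_sum_sq_term_mixed[OF mixed(2,6) False M(1)] M mixed by simp
    qed
  qed
  have "zinb_sum sq_term = (\<lambda>W. snd (zcmp brackets 1 brackets W))"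
    by (simp add: snd_zcmp fun_eq_iff)
  then have "slot_additive (zinb_sum sq_term)"
    using zcmp_slot_additive[OF brackets_multilinear brackets_multilinear, of 1]
    by (simp add: slot_additive_def)
  then have "zinb_sum sq_term W = 0" if "W \<noteq> []" "hom (\<lambda>d. HE d \<times> HV d) W" for W
    by (rule slot_additive_eq_zeroI[where f = "zinb_sum sq_term", OF _ pure that(2,1)])
  then show "loday_sq_zero (\<lambda>d. HE d \<times> HV d) brackets"
    unfolding loday_sq_zero_def by (simp add: prod_eq_iff fst_zcmp snd_zcmp)
next
  assume loday: "loday_sq_zero (\<lambda>d. HE d \<times> HV d) brackets"
  \<comment> \<open>Zero lies in every homogeneous part, so homogeneous letters of E or V alone are
    homogeneous in the sum.\<close>
  have "0 \<in> HE d" "0 \<in> HV d" for d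
    using lie_E lie_V by (auto simp: lie_infty_def graded_space_def subspace_def)
  then have hom_in: "hom (\<lambda>d. HE d \<times> HV d) (map inE xs)" "hom (\<lambda>d. HE d \<times> HV d) (map inV vs)"
    if "hom HE xs" "hom HV vs" for xs vs
    using that by (auto simp: hom_def inE_def inV_def)
  have "commutator xs vs ys ws = 0"
    if "hom HE xs" "hom HV vs" "hom HE ys" "hom HV ws" "vs \<noteq> []" "ys \<noteq> []" "ws \<noteq> []" for xs vs ys ws
    using that
  \<comment> \<open>\<open>ys\<close> is generalised because the hypothesis is applied to
    \<open>R @ ys\<close>, the letters of \<open>R\<close> having moved over from
    \<open>xs\<close>.\<close>
  proof (induction "length xs" arbitrary: xs ys rule: less_induct)
    case less
    obtain v vs0 where v: "vs = v # vs0"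
      using less.prems by (cases vs) auto
    obtain ys0 y where y: "ys = ys0 @ [y]"
      using less.prems by (cases ys rule: rev_cases) auto
    \<comment> \<open>The test word is \<open>xs vs ys ws\<close>; its middle part is already in the
      order of \<open>sorting_sorted\<close>, so the sorting sign is 1.\<close>
    let ?W = "map inE xs @ (inV v # (map inV vs0 @ map inE ys0) @ [inE y]) @ map inV ws"
    have W: "?W = map inE xs @ map inV vs @ map inE ys @ map inV ws"
      by (simp add: v y)
    have "hom (\<lambda>d. HE d \<times> HV d) ?W" "?W \<noteq> []"
      unfolding W using less.prems hom_in by auto
    then have "zinb_sum sq_term ?W = 0"
      using loday unfolding loday_sq_zero_def snd_zcmp[symmetric] by simp
    then have "0 = unsh_sum (\<lambda>L R. (- ksgn (degsum R * degsum vs)) *\<^sub>R commutator L vs (R @ ys) ws) xs"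
      using zinb_sum_sq_term_mixed[OF less.prems(1,4,7) sorting_sorted, of v vs0 ys0 y] less.prems
      by (simp add: v y)
    \<comment> \<open>Every splitting with nonempty \<open>R\<close> leaves a shorter
      \<open>L\<close> and vanishes by induction; what remains is the wanted commutator with
      coefficient -1.\<close>
    also have "\<dots> = (- ksgn (degsum ([] :: (int \<times> 'e) list) * degsum vs)) *\<^sub>R commutator xs vs ([] @ ys) ws"
    proof (rule unsh_sum_eq_single)
      fix L R assume R: "R \<noteq> []" and mset: "mset L + mset R = mset xs"
      then have "length L < length xs"
        by (metis length_greater_0_conv less_add_same_cancel1 size_mset size_union)
      moreover have "hom HE L" "hom HE R"
        using hom_unsh_sum[OF mset less.prems(1)] by auto
      ultimately have "commutator L vs (R @ ys) ws = 0"
        using less.prems by (intro less.hyps) auto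
      then show "(- ksgn (degsum R * degsum vs)) *\<^sub>R commutator L vs (R @ ys) ws = 0"
        by simp
    qed
    finally show ?case
      by simp
  qed
  then show "coherent HE HV m \<Phi>"
    unfolding coherent_iff_commutator by blast
qed

end

theorem theoremA:
  fixes HE :: "int \<Rightarrow> 'e::real_vector set" and HV :: "int \<Rightarrow> 'v::real_vector set"
    and l :: "'e list \<Rightarrow> 'e" and m :: "'v list \<Rightarrow> 'v"
    and \<Phi> :: "'e list \<Rightarrow> 'v list \<Rightarrow> 'v"
  assumes "lie_infty HE l" and "lie_infty HV m" and "lie_infty_action HE l HV m \<Phi>"
  shows "loday_sq_zero (\<lambda>d. HE d \<times> HV d) (semidirect_brackets l \<Phi> m) \<longleftrightarrow> coherent HE HV m \<Phi>"
proof -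
  interpret lie_infty_action_data HE HV l m \<Phi>
    using assms by unfold_locales
  show ?thesis
    by (rule loday_iff_coherent)
qed

end
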